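(* Let $u\le w$ in $\mathbb{P}^*$ under generalized factor order. Then $$\mu(u,w)=d(u,w)+\sum(-1)^i\left(\nu(u,p)-\nu(u,x(p))\right),$$ where the sum runs over all pairs $(v,p)$ such that $p$ is a principal factor of $w$ of degree $i$ with base $v$; here $x(p)$ is the primary prefix of $p$ relative to $v$, and $\nu(u,x(p))=0$ when $x(p)$ is undefined.
   Context: $\mathbb{P}=\{1,2,\dots\}$ with its usual order, and $\mathbb{P}^*$ is the set of finite words over $\mathbb{P}$. Generalized factor order: $u\le w$ iff there is $i\ge0$ with $u(j)\le w(i+j)$ for $1\le j\le|u|$. $\mu$ is its Möbius function; set $\mu(u,v)=0$ if $v$ is undefined or $u\not\le v$. Basic notions. - A word is flat if all its letters are $1$. - An embedding of $u$ into $w$ is a word $\eta\in0^*u0^*$ of length $|w|$ with $\eta(i)\le w(i)$ for all $i$ (with $0<1$). The prefix embedding of a prefix $p$ of $w$ is $p0^{|w|-|p|}$. - In an embedding $\eta$ of a word $v$, the letter $\eta(i)$ is reducible if $\eta(i)>1$, or $\eta(i)=1$ is the first nonzero letter, or $v$ is not flat and $\eta(i)=1$ is the last nonzero letter. Reducing it replaces it by $\eta(i)-1$. - In a word $w$, $w(i)$ is reducible if $w(i)>1$, or $w(i)=1$ and $i=1$, or $w(i)=1$, $i=|w|$ and $w$ is not flat. Reducing $w(i)$ lowers it by $1$, deleting it if it was $1$. Chain ids. A maximal chain $C: w=v_0\to\dots\to v_n=u$ determines embeddings $\eta_{v_i}$ and labels $l_i$ as follows: $\eta_{v_0}=w$,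 and $\eta_{v_i}$ is obtained from $\eta_{v_{i-1}}$ by reducing the reducible letter in position $l_i$. The chain id $l_1\cdots l_n$ is unique to $C$. Maximal chains are ordered lexicographically by chain id. - $v_i$ is a descent if $l_i>l_{i+1}$. - A descent is strong if $v_{i-1}\ne v_{i+1}11$. Critical chains. For $i<j$, $C(v_i,v_j)=\{v_{i+1},\dots,v_{j-1}\}$. - A nonempty $C(v_i,v_j)$ is skipped if $C\setminus C(v_i,v_j)\subseteq C'$ for some earlier maximal chain $C'$. - It is an MSI if it properly contains no skipped interval. $I(C)$ is the set of MSIs. - Build $J(C)$ as follows. Order $I(C)$ by the smallest index of their elements and let $J_1$ be the first. Inductively, replace each remaining interval by its difference with $J_1\cup\dots\cup J_k$, discard empty and non-containment-minimal ones, and let $J_{k+1}$ be the first remaining one. - $C$ is critical if $\bigcup J(C)=C(v_0,v_n)$. Rank and $d$. Let $\rho(v)=\sum_j v(j)$ and $\rho(u,w)=\rho(w)-\rho(u)$. Let $t$ be the number of critical maximal chains of $[u,w]$ all of whose words $v_1,\dots,v_{n-1}$ are strong descents. Define $d(u,w)=t(-1)^{\rho(u,w)}$ if $\rho(u,w)>1$, and $d(u,w)=(-1)^{\rho(u,w)}$ otherwise. Principal factors. - $p$ is a prefix of $w$ if $|p|\le|w|$ and $p(j)\le w(j)$ for $j\le |p|$; a suffix is defined analogously with the positions aligned at the end. A prefix or suffix is proper if $|p|<|w|$. - An outer factor of $w$ is a word that is both a proper prefix and a proper suffix of $w$. A maximal outer factor is an outer factor not contained in a longer outer factor. - For a non-flat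 maximal outer factor $p$ of $w$, its principal index is the smallest $i$ with $w(i)>p(i)$ (taking $p(i)=0$ for $i>|p|$) and $w(i)$ reducible. - $p$ is a principal factor of $w$ if reducing $w(i)$ yields a word that no longer has $p$ as a suffix. Bases. - A base of $w$ is a word $v$ with $|v|\in\{|w|,|w|-1\}$ such that, writing $v(|w|)=0$ if $|v|=|w|-1$, $v(j)\in\{w(j),w(j)-1\}$ for all $j\le|w|$. - Its degree is the number of $j$ with $v(j)=w(j)-1$. - For a base $v$ of degree $i$, let $\ell$ be the least such $j$, or $\ell=|w|+1$ if $i=0$. - A principal factor $p$ of $v$ with principal index (in $v$) less than $\ell$ is a principal factor of $w$ of degree $i$ with base $v$. Primary prefix and $\nu$. - $v\setminus1^m$ is $v$ with $m$ trailing $1$'s removed; it is undefined if $v$ ends in fewer than $m$ ones. - Let $v'$ be $v$ with the letter at the principal index of $p$ lowered by $1$. The primary prefix $x(p)$ is $p\setminus1^m$ for the smallest positive $m$ such that $p\setminus1^m$ is defined and is an outer factor of $v'$; it is undefined if no such $m$ exists. - $\nu(u,v)=\sum_{i\ge0}\mu(u,v\setminus1^i)$. *)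

theory Defs
  imports Main
begin

text \<open>
  A word over the positive integers is a \<^typ>\<open>nat list\<close> all of whose letters are positive;
  lists that also contain the letter 0 occur only as embeddings.  Positions are counted from 0
  throughout, so every index, label and position is one less than in the usual notation.  They
  are only ever compared with one another.
\<close>

definition pwords :: "nat list set" where
  "pwords = lists {1..}"

definition gf_le :: "nat list \<Rightarrow> nat list \<Rightarrow> bool"  (infix "\<le>\<^sub>g\<^sub>f" 50) where
  "u \<le>\<^sub>g\<^sub>f w \<longleftrightarrow> (\<exists>i. i + length u \<le> length w \<and> (\<forall>j<length u. u ! j \<le> w ! (i + j)))"

definition word_rank :: "nat list \<Rightarrow> nat" where
  "word_rank v = sum_list v"

definition rank_diff :: "nat list \<Rightarrow> nat list \<Rightarrow> nat" where
  "rank_diff u w = word_rank w - word_rank u"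


subsection \<open>The Moebius function\<close>

lemma gf_le_length: "u \<le>\<^sub>g\<^sub>f w \<Longrightarrow> length u \<le> length w"
  by (auto simp: gf_le_def)

lemma gf_le_refl: "u \<le>\<^sub>g\<^sub>f u"
  unfolding gf_le_def by (rule exI[of _ 0]) simp

lemma gf_le_letter_le:
  assumes "u \<le>\<^sub>g\<^sub>f w" "x \<in> set u"
  shows "x \<le> sum_list w"
proof -
  obtain i where i: "i + length u \<le> length w" "\<forall>j<length u. u ! j \<le> w ! (i + j)"
    using assms(1) by (auto simp: gf_le_def)
  obtain j where j: "j < length u" "x = u ! j"
    using assms(2) by (auto simp: in_set_conv_nth)
  have "x \<le> w ! (i + j)" using i j by auto
  also have "\<dots> \<le> sum_list w"
    using i j by (intro member_le_sum_list) auto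
  finally show ?thesis .
qed

lemma finite_gf_le: "finite {z. z \<le>\<^sub>g\<^sub>f w}"
proof (rule finite_subset)
  show "{z. z \<le>\<^sub>g\<^sub>f w} \<subseteq> {z. set z \<subseteq> {..sum_list w} \<and> length z \<le> length w}"
    using gf_le_letter_le gf_le_length by auto
  show "finite {z. set z \<subseteq> {..sum_list w} \<and> length z \<le> length w}"
    by (rule finite_lists_length_le) simp
qed

lemma gf_less_rank:
  assumes "z \<le>\<^sub>g\<^sub>f w" "z \<noteq> w" "w \<in> pwords"
  shows "word_rank z < word_rank w"
proof -
  obtain i where i: "i + length z \<le> length w" "\<forall>j<length z. z ! j \<le> w ! (i + j)"
    using assms(1) by (auto simp: gf_le_def)
  have pos: "0 < w ! k" if "k < length w" for k
  proof -
    have "w ! k \<in> set w" using that by simp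
    then show ?thesis using assms(3) by (auto simp: pwords_def Suc_le_eq)
  qed
  let ?m = "length z"
  have z: "sum_list z = (\<Sum>j<?m. z ! j)" by (simp add: sum_list_sum_nth atLeast0LessThan)
  have w: "sum_list w = (\<Sum>k<length w. w ! k)" by (simp add: sum_list_sum_nth atLeast0LessThan)
  have shift: "(\<Sum>j<?m. w ! (i + j)) = (\<Sum>k\<in>{i..<i + ?m}. w ! k)"
    by (rule sum.reindex_bij_witness[of _ "\<lambda>k. k - i" "\<lambda>j. i + j"]) auto
  show ?thesis
  proof (cases "?m = length w")
    case True
    then have "i = 0" using i by simp
    then have le: "\<forall>j<?m. z ! j \<le> w ! j" using i by simp
    obtain j where "j < ?m" "z ! j \<noteq> w ! j"
      using assms(2) True nth_equalityI by blast
    then have "\<exists>j\<in>{..<?m}. z ! j < w ! j"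
      using le by (metis lessThan_iff nat_less_le)
    then have "(\<Sum>j<?m. z ! j) < (\<Sum>j<?m. w ! j)"
      using le by (intro sum_strict_mono_ex1) simp_all
    then show ?thesis using z w True by (simp add: word_rank_def)
  next
    case False
    then have lt: "?m < length w" using i by simp
    have "(\<Sum>j<?m. z ! j) \<le> (\<Sum>k\<in>{i..<i + ?m}. w ! k)"
      unfolding shift[symmetric] using i by (intro sum_mono) auto
    also have "\<dots> < (\<Sum>k<length w. w ! k)"
    proof -
      have "\<exists>k<length w. k \<notin> {i..<i + ?m}"
      proof (rule ccontr)
        assume "\<not> ?thesis"
        then have "{..<length w} \<subseteq> {i..<i + ?m}" by blast
        then have "card {..<length w} \<le> card {i..<i + ?m}" by (intro card_mono) auto
        then show False using lt by simp
      qed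
      then obtain k where "k < length w" "k \<notin> {i..<i + ?m}" by blast
      then show ?thesis
        using i(1) pos[of k] by (intro sum_strict_mono2[where b = k]) auto
    qed
    finally show ?thesis using z w by (simp add: word_rank_def)
  qed
qed

function gf_mu :: "nat list \<Rightarrow> nat list \<Rightarrow> int" where
  "gf_mu u w =
     (if u \<notin> pwords \<or> w \<notin> pwords \<or> \<not> u \<le>\<^sub>g\<^sub>f w then 0
      else if u = w then 1
      else - (\<Sum>z\<in>{z \<in> pwords. u \<le>\<^sub>g\<^sub>f z \<and> z \<le>\<^sub>g\<^sub>f w \<and> z \<noteq> w}. gf_mu u z))"
  by pat_completeness auto
termination
  by (relation "measure (\<lambda>(u, w). word_rank w)") (auto intro: gf_less_rank)

declare gf_mu.simps [simp del]

lemma gf_mu_refl: "u \<in> pwords \<Longrightarrow> gf_mu u u = 1"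
  by (simp add: gf_mu.simps gf_le_refl)

lemma gf_mu_sum:
  assumes "u \<in> pwords" "w \<in> pwords" "u \<le>\<^sub>g\<^sub>f w" "u \<noteq> w"
  shows "(\<Sum>z\<in>{z \<in> pwords. u \<le>\<^sub>g\<^sub>f z \<and> z \<le>\<^sub>g\<^sub>f w}. gf_mu u z) = 0"
proof -
  let ?B = "{z \<in> pwords. u \<le>\<^sub>g\<^sub>f z \<and> z \<le>\<^sub>g\<^sub>f w \<and> z \<noteq> w}"
  have eq: "{z \<in> pwords. u \<le>\<^sub>g\<^sub>f z \<and> z \<le>\<^sub>g\<^sub>f w} = insert w ?B"
    using assms gf_le_refl by blast
  have fin: "finite ?B"
    by (rule finite_subset[OF _ finite_gf_le[of w]]) blast
  have "gf_mu u w = - (\<Sum>z\<in>?B. gf_mu u z)"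
    using assms by (subst gf_mu.simps) simp
  then show ?thesis unfolding eq using fin by simp
qed


subsection \<open>Flat words, embeddings and reductions\<close>

definition flat :: "nat list \<Rightarrow> bool" where
  "flat v \<longleftrightarrow> (\<forall>a\<in>set v. a = 1)"

definition word_embedding :: "nat list \<Rightarrow> nat list \<Rightarrow> nat list \<Rightarrow> bool" where
  "word_embedding \<eta> u w \<longleftrightarrow>
     (\<exists>a b. \<eta> = replicate a 0 @ u @ replicate b 0) \<and>
     length \<eta> = length w \<and> (\<forall>i<length w. \<eta> ! i \<le> w ! i)"

text \<open>Reducibility of a letter in an embedding \<open>\<eta>\<close> of the word \<open>v\<close>.\<close>

definition emb_reducible :: "nat list \<Rightarrow> nat list \<Rightarrow> nat \<Rightarrow> bool" where
  "emb_reducible \<eta> v i \<longleftrightarrow> i < length \<eta> \<and>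
     (\<eta> ! i > 1 \<or>
      \<eta> ! i = 1 \<and> (\<forall>j<i. \<eta> ! j = 0) \<or>
      \<not> flat v \<and> \<eta> ! i = 1 \<and> (\<forall>j. i < j \<and> j < length \<eta> \<longrightarrow> \<eta> ! j = 0))"

definition emb_reduce :: "nat list \<Rightarrow> nat \<Rightarrow> nat list" where
  "emb_reduce \<eta> i = \<eta>[i := \<eta> ! i - 1]"

definition word_reducible :: "nat list \<Rightarrow> nat \<Rightarrow> bool" where
  "word_reducible w i \<longleftrightarrow> i < length w \<and>
     (w ! i > 1 \<or>
      w ! i = 1 \<and> i = 0 \<or>
      w ! i = 1 \<and> Suc i = length w \<and> \<not> flat w)"

definition word_reduce :: "nat list \<Rightarrow> nat \<Rightarrow> nat list" where
  "word_reduce w i =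
     (if w ! i = 1 then take i w @ drop (Suc i) w else w[i := w ! i - 1])"


subsection \<open>Maximal chains and chain ids\<close>

definition gf_covered_by :: "nat list \<Rightarrow> nat list \<Rightarrow> bool" where
  "gf_covered_by x y \<longleftrightarrow> x \<le>\<^sub>g\<^sub>f y \<and> x \<noteq> y \<and>
     \<not> (\<exists>z\<in>pwords. x \<le>\<^sub>g\<^sub>f z \<and> z \<le>\<^sub>g\<^sub>f y \<and> z \<noteq> x \<and> z \<noteq> y)"

text \<open>
  Maximal chains of the interval \<open>[u, w]\<close> are listed from the top, \<open>C = [v\<^sub>0, \<dots>, v\<^sub>n]\<close> with
  \<open>v\<^sub>0 = w\<close> and \<open>v\<^sub>n = u\<close>; thus \<open>n = length C - 1\<close>.
\<close>

definition max_chains :: "nat list \<Rightarrow> nat list \<Rightarrow> nat list list set" where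
  "max_chains u w = {C. C \<noteq> [] \<and> hd C = w \<and> last C = u \<and> set C \<subseteq> pwords \<and>
     (\<forall>i. Suc i < length C \<longrightarrow> gf_covered_by (C ! Suc i) (C ! i))}"

text \<open>The label \<open>l\<^sub>i\<close> of the step from \<open>v\<^bsub>i-1\<^esub>\<close> to \<open>v\<^sub>i\<close> is the entry \<open>i - 1\<close> of the chain id.\<close>

definition is_chain_id :: "nat list list \<Rightarrow> nat list \<Rightarrow> bool" where
  "is_chain_id C l \<longleftrightarrow> length C = Suc (length l) \<and>
     (\<exists>\<eta>. \<eta> 0 = C ! 0 \<and>
        (\<forall>i\<le>length l. word_embedding (\<eta> i) (C ! i) (C ! 0)) \<and>
        (\<forall>i<length l. emb_reducible (\<eta> i) (C ! i) (l ! i) \<and>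
                      \<eta> (Suc i) = emb_reduce (\<eta> i) (l ! i)))"

definition chain_id :: "nat list list \<Rightarrow> nat list" where
  "chain_id C = (THE l. is_chain_id C l)"

definition earlier_chain :: "nat list list \<Rightarrow> nat list list \<Rightarrow> bool" where
  "earlier_chain C' C \<longleftrightarrow> (chain_id C', chain_id C) \<in> lexord {(a, b). a < b}"

definition descent :: "nat list list \<Rightarrow> nat \<Rightarrow> bool" where
  "descent C i \<longleftrightarrow> 0 < i \<and> Suc i < length C \<and> chain_id C ! (i - 1) > chain_id C ! i"

definition strong_descent :: "nat list list \<Rightarrow> nat \<Rightarrow> bool" where
  "strong_descent C i \<longleftrightarrow> descent C i \<and> C ! (i - 1) \<noteq> C ! Suc i @ [1, 1]"


subsection \<open>Critical chains\<close>

definition open_interval :: "nat list list \<Rightarrow> nat \<Rightarrow> nat \<Rightarrow> nat list set" where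
  "open_interval C i j = {C ! k | k. i < k \<and> k < j}"

definition skipped_intervals :: "nat list \<Rightarrow> nat list \<Rightarrow> nat list list \<Rightarrow> nat list set set" where
  "skipped_intervals u w C = {open_interval C i j | i j.
     i < j \<and> j < length C \<and> open_interval C i j \<noteq> {} \<and>
     (\<exists>C'\<in>max_chains u w. earlier_chain C' C \<and> set C - open_interval C i j \<subseteq> set C')}"

definition MSIs :: "nat list \<Rightarrow> nat list \<Rightarrow> nat list list \<Rightarrow> nat list set set" where
  "MSIs u w C = {I \<in> skipped_intervals u w C. \<not> (\<exists>K\<in>skipped_intervals u w C. K \<subset> I)}"

definition first_index :: "nat list list \<Rightarrow> nat list set \<Rightarrow> nat" where
  "first_index C I = (LEAST k. k < length C \<and> C ! k \<in> I)"

text \<open>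
  The families to which this is applied are antichains of intervals of \<open>C\<close>, so the minimum is
  attained only once.
\<close>

definition first_interval :: "nat list list \<Rightarrow> nat list set set \<Rightarrow> nat list set" where
  "first_interval C R = (ARG_MIN (first_index C) I. I \<in> R)"

definition minimal_nonempty :: "'a set set \<Rightarrow> 'a set set" where
  "minimal_nonempty F = {S \<in> F - {{}}. \<not> (\<exists>T\<in>F - {{}}. T \<subset> S)}"

text \<open>
  After \<open>k\<close> rounds: the intervals \<open>J\<^sub>1, \<dots>, J\<^sub>k\<close> chosen so far, and the (truncated) intervals that
  remain.  An interval that has been discarded does not come back in a later round.
\<close>

primrec J_rounds ::
  "nat list list \<Rightarrow> nat list set set \<Rightarrow> nat \<Rightarrow> nat list set set \<times> nat list set set" where
  "J_rounds C I 0 = ({}, I)"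
| "J_rounds C I (Suc k) = (case J_rounds C I k of (J, R) \<Rightarrow>
     if R = {} then (J, R)
     else let K = first_interval C R; J' = insert K J
          in (J', minimal_nonempty ((\<lambda>S. S - \<Union>J') ` (R - {K}))))"

definition J_intervals :: "nat list \<Rightarrow> nat list \<Rightarrow> nat list list \<Rightarrow> nat list set set" where
  "J_intervals u w C = (\<Union>k. fst (J_rounds C (MSIs u w C) k))"

definition critical_chain :: "nat list \<Rightarrow> nat list \<Rightarrow> nat list list \<Rightarrow> bool" where
  "critical_chain u w C \<longleftrightarrow> C \<in> max_chains u w \<and>
     \<Union>(J_intervals u w C) = open_interval C 0 (length C - 1)"

definition gf_d :: "nat list \<Rightarrow> nat list \<Rightarrow> int" where
  "gf_d u w =
     (if rank_diff u w > 1
      then int (card {C. critical_chain u w C \<and>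
                         (\<forall>i. 0 < i \<and> Suc i < length C \<longrightarrow> strong_descent C i)})
           * (-1) ^ rank_diff u w
      else (-1) ^ rank_diff u w)"


subsection \<open>Principal factors\<close>

definition gf_prefix :: "nat list \<Rightarrow> nat list \<Rightarrow> bool" where
  "gf_prefix p w \<longleftrightarrow> length p \<le> length w \<and> (\<forall>j<length p. p ! j \<le> w ! j)"

definition gf_suffix :: "nat list \<Rightarrow> nat list \<Rightarrow> bool" where
  "gf_suffix p w \<longleftrightarrow> length p \<le> length w \<and>
     (\<forall>j<length p. p ! j \<le> w ! (length w - length p + j))"

definition outer_factor :: "nat list \<Rightarrow> nat list \<Rightarrow> bool" where
  "outer_factor p w \<longleftrightarrow> p \<in> pwords \<and> length p < length w \<and> gf_prefix p w \<and> gf_suffix p w"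

text \<open>
  Only strictly longer outer factors count here: a maximal outer factor may well lie below
  another outer factor of the same length.
\<close>

definition maximal_outer_factor :: "nat list \<Rightarrow> nat list \<Rightarrow> bool" where
  "maximal_outer_factor p w \<longleftrightarrow> outer_factor p w \<and>
     \<not> (\<exists>q. outer_factor q w \<and> length p < length q \<and> p \<le>\<^sub>g\<^sub>f q)"

definition letter0 :: "nat list \<Rightarrow> nat \<Rightarrow> nat" where
  "letter0 p i = (if i < length p then p ! i else 0)"

definition principal_index :: "nat list \<Rightarrow> nat list \<Rightarrow> nat" where
  "principal_index w p =
     (LEAST i. i < length w \<and> w ! i > letter0 p i \<and> word_reducible w i)"

definition principal_factor :: "nat list \<Rightarrow> nat list \<Rightarrow> bool" where
  "principal_factor p w \<longleftrightarrow> maximal_outer_factor p w \<and> \<not> flat p \<and>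
     \<not> gf_suffix p (word_reduce w (principal_index w p))"


subsection \<open>Bases and principal factors of higher degree\<close>

definition is_base :: "nat list \<Rightarrow> nat list \<Rightarrow> bool" where
  "is_base v w \<longleftrightarrow> v \<in> pwords \<and> (length v = length w \<or> Suc (length v) = length w) \<and>
     (\<forall>j<length w. letter0 v j = w ! j \<or> letter0 v j = w ! j - 1)"

definition lowered :: "nat list \<Rightarrow> nat list \<Rightarrow> nat set" where
  "lowered v w = {j. j < length w \<and> letter0 v j = w ! j - 1}"

definition base_degree :: "nat list \<Rightarrow> nat list \<Rightarrow> nat" where
  "base_degree v w = card (lowered v w)"

definition base_ell :: "nat list \<Rightarrow> nat list \<Rightarrow> nat" where
  "base_ell v w = (if base_degree v w = 0 then length w else (LEAST j. j \<in> lowered v w))"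

definition principal_factor_deg ::
  "nat list \<Rightarrow> nat list \<Rightarrow> nat \<Rightarrow> nat list \<Rightarrow> bool" where
  "principal_factor_deg p w i v \<longleftrightarrow> is_base v w \<and> base_degree v w = i \<and>
     principal_factor p v \<and> principal_index v p < base_ell v w"


subsection \<open>Primary prefixes and \<open>\<nu>\<close>\<close>

definition remove_ones :: "nat list \<Rightarrow> nat \<Rightarrow> nat list option" where
  "remove_ones v m =
     (if \<exists>x. v = x @ replicate m 1 then Some (take (length v - m) v) else None)"

definition primary_prefix :: "nat list \<Rightarrow> nat list \<Rightarrow> nat list option" where
  "primary_prefix v p =
     (let v' = word_reduce v (principal_index v p);
          ok = (\<lambda>m. 0 < m \<and> (\<exists>x. remove_ones p m = Some x \<and> outer_factor x v'))
      in if \<exists>m. ok m then remove_ones p (LEAST m. ok m) else None)"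

text \<open>At most \<open>length v\<close> trailing ones can be removed; all further summands are undefined, i.e. 0.\<close>

definition gf_nu :: "nat list \<Rightarrow> nat list \<Rightarrow> int" where
  "gf_nu u v =
     (\<Sum>i\<le>length v. case remove_ones v i of None \<Rightarrow> 0 | Some x \<Rightarrow> gf_mu u x)"

end

theory Submission
  imports Defs
begin

text \<open>
  For a set \<open>S\<close> of reducible positions of \<open>w\<close> let \<open>w\<^sup>S\<close> be \<open>w\<close> with the letters in \<open>S\<close> lowered by 1.
  Chains of strong descents starting at \<open>w\<close> lower distinct positions from right to left, and they
  correspond to the sets \<open>S\<close>; each of them is critical because every inner element can be
  exchanged alone for an earlier one.  Hence \<open>d(u, w)\<close> is the sum of \<open>(-1)\<^bsup>|S|\<^esup>\<close> over all \<open>S\<close> with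
  \<open>w\<^sup>S = u\<close>, and by Moebius inversion the theorem is equivalent to the identity
  \[ \sum_S (-1)^{|S|} [z \le w^S] = [z = w] - \sum_{(v,p)} (-1)^{\deg v} [z \in T(v,p)] \]
  for all words \<open>z\<close>, where \<open>T(v,p)\<close> consists of the \<open>p \<setminus> 1\<^sup>m\<close> that are not of the form
  \<open>x(p) \<setminus> 1\<^sup>m\<close>.  Split \<open>[z \<le> w\<^sup>S]\<close> into the occurrences of \<open>z\<close> at position 0, those at positive
  positions, and, with negative sign, the case that both exist.  Toggling one position in \<open>S\<close>
  evaluates the first sum to \<open>[z = w]\<close> and the second to 0.  In the third, toggling the first
  position at which \<open>w\<close> exceeds both 1 and \<open>z\<close> cancels all but those \<open>S\<close> for which \<open>z\<close> occurs twice
  in \<open>w\<^sup>S\<close> but not after lowering that position; these \<open>S\<close> are the bases \<open>v\<close> having a principal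
  factor \<open>p = z1\<^sup>m\<close> with \<open>z \<in> T(v,p)\<close>, where \<open>m\<close> is read off the first positive position of \<open>z\<close> in \<open>v\<close>.
\<close>

subsection \<open>Occurrences of factors\<close>

lemma pwords_iff: "w \<in> pwords \<longleftrightarrow> (\<forall>i<length w. 0 < w ! i)"
  by (auto simp: pwords_def in_lists_conv_set in_set_conv_nth Suc_le_eq)

lemma flat_iff: "flat w \<longleftrightarrow> (\<forall>i<length w. w ! i = 1)"
  unfolding flat_def by (metis in_set_conv_nth)

definition occurs_at :: "nat list \<Rightarrow> nat list \<Rightarrow> nat \<Rightarrow> bool" where
  "occurs_at z w k \<longleftrightarrow> k + length z \<le> length w \<and> (\<forall>j<length z. z ! j \<le> w ! (k + j))"

lemma gf_le_iff_occurs: "z \<le>\<^sub>g\<^sub>f w \<longleftrightarrow> (\<exists>k. occurs_at z w k)"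
  by (simp add: gf_le_def occurs_at_def)

lemma occurs_at_trans:
  assumes "occurs_at x y k" "occurs_at y z l"
  shows "occurs_at x z (l + k)"
  unfolding occurs_at_def
proof (intro conjI allI impI)
  show "l + k + length x \<le> length z" using assms by (simp add: occurs_at_def)
  fix j assume "j < length x"
  then have "x ! j \<le> y ! (k + j)" "y ! (k + j) \<le> z ! (l + (k + j))"
    using assms by (auto simp: occurs_at_def)
  then show "x ! j \<le> z ! (l + k + j)" by (simp add: add.assoc)
qed

lemma gf_le_trans: "x \<le>\<^sub>g\<^sub>f y \<Longrightarrow> y \<le>\<^sub>g\<^sub>f z \<Longrightarrow> x \<le>\<^sub>g\<^sub>f z"
  unfolding gf_le_iff_occurs using occurs_at_trans by blast

lemma gf_prefix_iff: "gf_prefix p w \<longleftrightarrow> occurs_at p w 0"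
  by (simp add: gf_prefix_def occurs_at_def)

lemma gf_suffix_iff: "gf_suffix p w \<longleftrightarrow> length p \<le> length w \<and> occurs_at p w (length w - length p)"
  by (auto simp: gf_suffix_def occurs_at_def)

lemma outer_factor_iff:
  "outer_factor p w \<longleftrightarrow> p \<in> pwords \<and> length p < length w \<and> occurs_at p w 0 \<and>
     occurs_at p w (length w - length p)"
  by (auto simp: outer_factor_def gf_prefix_iff gf_suffix_iff)

text \<open>Letters of \<open>v\<close> are positive, so an occurrence extends by ones as long as
  there is room. This is how a repeated word is completed to an outer factor.\<close>

lemma occurs_at_append_ones:
  assumes "occurs_at z v k" "v \<in> pwords" "k + length z + m \<le> length v"
  shows "occurs_at (z @ replicate m 1) v k"
  unfolding occurs_at_def
proof (intro conjI allI impI)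
  show "k + length (z @ replicate m 1) \<le> length v" using assms(3) by simp
  fix j assume "j < length (z @ replicate m 1)"
  then have j: "k + j < length v" "j < length z + m" using assms(3) by auto
  then have "0 < v ! (k + j)" using assms(2) by (simp add: pwords_iff)
  then show "(z @ replicate m 1) ! j \<le> v ! (k + j)"
    using assms(1) j by (auto simp: nth_append occurs_at_def)
qed

lemma occurs_at_appendD:
  assumes "occurs_at (z @ y) v k"
  shows "occurs_at z v k"
  unfolding occurs_at_def
proof (intro conjI allI impI)
  show "k + length z \<le> length v" using assms by (simp add: occurs_at_def)
  fix j assume "j < length z"
  then have "(z @ y) ! j \<le> v ! (k + j)" using assms by (simp add: occurs_at_def)
  then show "z ! j \<le> v ! (k + j)" using \<open>j < length z\<close> by (simp add: nth_append)
qed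

text \<open>The last letter of \<open>z\<close> is positive and cannot face a padding zero, so every
  occurrence ends inside \<open>v\<close>. It lets a word whose last letter 1 was lowered to 0 be
  compared with the shorter word.\<close>

lemma occurs_at_append_zeros:
  assumes "z \<in> pwords" "z \<noteq> []"
  shows "occurs_at z (v @ replicate c 0) k \<longleftrightarrow> occurs_at z v k"
proof
  assume a: "occurs_at z (v @ replicate c 0) k"
  have "k + (length z - 1) < length v"
  proof (rule ccontr)
    assume c: "\<not> ?thesis"
    have "z ! (length z - 1) \<le> (v @ replicate c 0) ! (k + (length z - 1))"
      using a assms by (auto simp: occurs_at_def)
    moreover have "k + (length z - 1) - length v < c"
      using a c assms(2) by (cases z) (auto simp: occurs_at_def)
    ultimately show False
      using c assms by (auto simp: nth_append pwords_iff dest: spec[of _ "length z - 1"])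
  qed
  then show "occurs_at z v k"
    using a assms(2) by (cases z) (auto simp: occurs_at_def nth_append less_Suc_eq_le)
next
  assume "occurs_at z v k"
  then show "occurs_at z (v @ replicate c 0) k"
    by (auto simp: occurs_at_def nth_append)
qed

lemma letter0_append_ones:
  shows "letter0 z i \<le> letter0 (z @ replicate m 1) i"
    and "letter0 (z @ replicate m 1) i \<le> max 1 (letter0 z i)"
  by (auto simp: letter0_def nth_append)

text \<open>The last letter of \<open>z\<close> exceeding 1 is matched, \<open>k\<close> positions later, by a letter of \<open>v\<close>
  that is too large for the occurrence of \<open>z\<close> at position 0.\<close>

lemma shifted_occurrence_gap:
  assumes "\<not> flat z" "z \<in> pwords" "occurs_at z v k" "0 < k"
  shows "\<exists>i<length v. max 1 (letter0 z i) < v ! i"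
proof -
  let ?P = "\<lambda>j. j < length z \<and> 1 < z ! j"
  have "\<exists>j. ?P j"
    using assms(1,2) by (force simp: flat_iff pwords_iff)
  moreover have "\<forall>j. ?P j \<longrightarrow> j \<le> length z" by simp
  ultimately obtain j where j: "?P j" "\<forall>i. ?P i \<longrightarrow> i \<le> j"
    using Nat.ex_has_greatest_nat[of ?P] by blast
  have "z ! j \<le> v ! (k + j)" "k + j < length v"
    using assms(3) j(1) by (auto simp: occurs_at_def)
  moreover have "letter0 z (k + j) \<le> 1"
    using j(2) assms(4) by (auto simp: letter0_def not_less[symmetric])
  ultimately show ?thesis using j(1) by (intro exI[of _ "k + j"]) auto
qed

subsection \<open>Signed sums over lowered words\<close>

text \<open>A lowered 1 stays as a 0 instead of being deleted, so that positions in \<open>w\<close>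
  keep their meaning and lowerings at different positions do not interfere.\<close>

definition lower :: "nat list \<Rightarrow> nat set \<Rightarrow> nat list" where
  "lower w S = map (\<lambda>i. if i \<in> S then w ! i - 1 else w ! i) [0..<length w]"

lemma length_lower [simp]: "length (lower w S) = length w"
  by (simp add: lower_def)

lemma nth_lower [simp]: "i < length w \<Longrightarrow> lower w S ! i = (if i \<in> S then w ! i - 1 else w ! i)"
  by (simp add: lower_def)

lemma lower_empty [simp]: "lower w {} = w"
  by (simp add: lower_def map_nth)

lemma lower_insert: "i \<notin> S \<Longrightarrow> i < length w \<Longrightarrow> lower w (insert i S) = (lower w S)[i := w ! i - 1]"
  by (rule nth_equalityI) (auto simp: nth_list_update)

lemma occurs_at_lower_mono:
  assumes "occurs_at z (lower w T) k" "S \<subseteq> T"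
  shows "occurs_at z (lower w S) k"
  unfolding occurs_at_def
proof (intro conjI allI impI)
  show "k + length z \<le> length (lower w S)" using assms(1) by (simp add: occurs_at_def)
  fix j assume "j < length z"
  then have "k + j < length w" "z ! j \<le> lower w T ! (k + j)"
    using assms(1) by (auto simp: occurs_at_def)
  then show "z ! j \<le> lower w S ! (k + j)"
    using assms(2) by (auto split: if_splits)
qed

text \<open>Each \<open>S\<close> without \<open>i\<close> is paired with \<open>insert i S\<close>,
  which has the opposite sign; only the difference of the two values survives.\<close>

lemma sum_Pow_toggle:
  fixes f :: "'a set \<Rightarrow> int"
  assumes "finite R" "i \<in> R"
  shows "(\<Sum>S\<in>Pow R. (-1) ^ card S * f S) =
    (\<Sum>S\<in>Pow (R - {i}). (-1) ^ card S * (f S - f (insert i S)))"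
proof -
  let ?A = "Pow (R - {i})"
  have R: "Pow R = ?A \<union> insert i ` ?A"
    using Pow_insert[of i "R - {i}"] assms(2) by (simp add: insert_absorb)
  have "(\<Sum>S\<in>Pow R. (-1) ^ card S * f S) =
      (\<Sum>S\<in>?A. (-1) ^ card S * f S) + (\<Sum>S\<in>insert i ` ?A. (-1) ^ card S * f S)"
    unfolding R using assms(1) by (intro sum.union_disjoint) auto
  also have "(\<Sum>S\<in>insert i ` ?A. (-1) ^ card S * f S) =
      (\<Sum>S\<in>?A. (-1) ^ card (insert i S) * f (insert i S))"
    by (rule sum.reindex_cong[of "insert i"]) (auto simp: inj_on_def)
  also have "\<dots> = (\<Sum>S\<in>?A. - ((-1) ^ card S * f (insert i S)))"
  proof (rule sum.cong)
    fix S assume S: "S \<in> ?A"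
    then have "finite S" "i \<notin> S" using assms(1) finite_subset by auto
    then show "(-1) ^ card (insert i S) * f (insert i S) = - ((-1) ^ card S * f (insert i S))"
      by simp
  qed simp
  finally show ?thesis
    by (simp add: sum.distrib[symmetric] right_diff_distrib)
qed

lemma sum_Pow_toggle_zero:
  fixes f :: "'a set \<Rightarrow> int"
  assumes "finite R" "i \<in> R" "\<And>S. S \<subseteq> R \<Longrightarrow> i \<notin> S \<Longrightarrow> f (insert i S) = f S"
  shows "(\<Sum>S\<in>Pow R. (-1) ^ card S * f S) = 0"
  unfolding sum_Pow_toggle[OF assms(1,2)] 
proof (intro sum.neutral ballI)
  fix S assume "S \<in> Pow (R - {i})"
  then have "S \<subseteq> R" "i \<notin> S" by auto
  then show "(-1) ^ card S * (f S - f (insert i S)) = 0" using assms(3) by simp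
qed

lemma finite_word_reducible: "finite (Collect (word_reducible w))"
  by (rule finite_subset[of _ "{..<length w}"]) (auto simp: word_reducible_def)

text \<open>Lowering \<open>w ! i\<close> by one spoils an occurrence only if the letter of
  \<open>z\<close> facing it equals \<open>w ! i\<close>. If no letter of \<open>z\<close> faces
  position \<open>i\<close>, the third hypothesis is vacuous.\<close>

lemma occurs_at_lower_insert:
  assumes "i \<notin> S" "i < length w"
    and "\<And>j. j < length z \<Longrightarrow> i = k + j \<Longrightarrow> z ! j < w ! i"
  shows "occurs_at z (lower w (insert i S)) k \<longleftrightarrow> occurs_at z (lower w S) k"
proof -
  have "z ! j \<le> lower w (insert i S) ! (k + j) \<longleftrightarrow> z ! j \<le> lower w S ! (k + j)"
    if "j < length z" "k + j < length w" for j
    using assms(1) assms(3)[of j] that by (cases "i = k + j") auto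
  then show ?thesis unfolding occurs_at_def length_lower
    by (meson add_less_cancel_left order_less_le_trans)
qed

text \<open>For \<open>z = w\<close> any lowering destroys the occurrence, so only
  \<open>S = {}\<close> counts; if \<open>z\<close> does not occur at the start of \<open>w\<close>,
  every term is 0. Otherwise some reducible letter of \<open>w\<close> exceeds the letter of
  \<open>z\<close> facing it, and toggling it cancels all terms in pairs.\<close>

lemma signed_sum_prefix:
  assumes z: "z \<in> pwords" and w: "w \<in> pwords" and "\<not> flat w"
  shows "(\<Sum>S\<in>Pow (Collect (word_reducible w)).
      (-1) ^ card S * of_bool (occurs_at z (lower w S) 0)) = (of_bool (z = w) :: int)"
proof -
  let ?R = "Collect (word_reducible w)"
  consider "z = w" | "\<not> occurs_at z w 0" "z \<noteq> w" | "occurs_at z w 0" "z \<noteq> w" by blast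
  then show ?thesis
  proof cases
    case 1
    have "of_bool (occurs_at z (lower w S) 0) = (of_bool (S = {}) :: int)" if "S \<in> Pow ?R" for S
    proof -
      have "\<not> occurs_at z (lower w S) 0" if "i \<in> S" for i
      proof -
        have i: "i < length w" using \<open>i \<in> S\<close> \<open>S \<in> Pow ?R\<close> by (auto simp: word_reducible_def)
        then have "0 < w ! i" using w by (simp add: pwords_iff)
        with i have "\<not> z ! i \<le> lower w S ! (0 + i)" using 1 \<open>i \<in> S\<close> by simp
        with i show ?thesis using 1 unfolding occurs_at_def by blast
      qed
      moreover have "occurs_at z (lower w {}) 0" using 1 by (simp add: occurs_at_def)
      ultimately have "occurs_at z (lower w S) 0 \<longleftrightarrow> S = {}" by blast
      then show ?thesis by simp
    qed
    then have "(\<Sum>S\<in>Pow ?R. (-1) ^ card S * of_bool (occurs_at z (lower w S) 0)) =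
        (\<Sum>S\<in>Pow ?R. (-1) ^ card S * (of_bool (S = {}) :: int))"
      by (intro sum.cong) auto
    also have "\<dots> = (\<Sum>S\<in>Pow ?R. if S = {} then 1 else 0)"
      by (intro sum.cong) auto
    finally show ?thesis using 1 finite_word_reducible[of w] by (simp add: sum.delta)
  next
    case 2
    then have "\<not> occurs_at z (lower w S) 0" for S
      using occurs_at_lower_mono[of z w S 0 "{}"] by auto
    then show ?thesis using 2 by simp
  next
    case 3
    \<comment> \<open>If the lengths agree, a position where the letters differ serves, as
      \<open>w\<close> exceeds 1 there. If \<open>z\<close> is shorter, the last position of
      \<open>w\<close> serves; it is reducible because \<open>w\<close> is not flat.\<close>
    obtain i where i: "word_reducible w i" "letter0 z i < w ! i" "i < length w"
    proof (cases "length z = length w")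
      case True
      then obtain i where "i < length w" "z ! i \<noteq> w ! i"
        using 3(2) nth_equalityI[of z w] by auto
      moreover from this have "z ! i \<le> w ! i" "0 < z ! i"
        using 3(1) True z by (auto simp: occurs_at_def pwords_iff)
      ultimately show ?thesis
        using True by (intro that[of i]) (auto simp: word_reducible_def letter0_def)
    next
      case False
      then have "length z < length w" using 3(1) by (auto simp: occurs_at_def)
      moreover from this have "0 < w ! (length w - 1)"
        using w by (simp add: pwords_iff)
      ultimately show ?thesis
        using \<open>\<not> flat w\<close>
        by (intro that[of "length w - 1"]) (auto simp: word_reducible_def letter0_def)
    qed
    have "occurs_at z (lower w (insert i S)) 0 \<longleftrightarrow> occurs_at z (lower w S) 0" if "i \<notin> S" for S
      using that i by (intro occurs_at_lower_insert) (auto simp: letter0_def)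
    then have "(\<Sum>S\<in>Pow ?R. (-1) ^ card S * of_bool (occurs_at z (lower w S) 0)) = (0::int)"
      using i(1) by (intro sum_Pow_toggle_zero[of _ i] finite_word_reducible) auto
    then show ?thesis using 3 by simp
  qed
qed

text \<open>Position 0 is always reducible and lies outside every occurrence at a positive position,
  so toggling it changes nothing.\<close>

lemma signed_sum_nonprefix:
  assumes "w \<in> pwords" "w \<noteq> []"
  shows "(\<Sum>S\<in>Pow (Collect (word_reducible w)).
      (-1) ^ card S * of_bool (\<exists>k>0. occurs_at z (lower w S) k)) = (0 :: int)"
proof (rule sum_Pow_toggle_zero[of _ 0])
  have "0 < w ! 0" using assms by (simp add: pwords_iff)
  then show "0 \<in> Collect (word_reducible w)" using assms(2) by (auto simp: word_reducible_def)
  show "of_bool (\<exists>k>0. occurs_at z (lower w (insert 0 S)) k) =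
      (of_bool (\<exists>k>0. occurs_at z (lower w S) k) :: int)" if "0 \<notin> S" for S
  proof -
    have "occurs_at z (lower w (insert 0 S)) k \<longleftrightarrow> occurs_at z (lower w S) k" if "0 < k" for k
      using \<open>0 \<notin> S\<close> that assms(2) by (intro occurs_at_lower_insert) auto
    then have "(\<exists>k>0. occurs_at z (lower w (insert 0 S)) k) \<longleftrightarrow> (\<exists>k>0. occurs_at z (lower w S) k)"
      by blast
    then show ?thesis by simp
  qed
qed (rule finite_word_reducible)

text \<open>A letter of \<open>w\<close> above 1 remains at least 1 when lowered, which is all that
  a flat word asks of it. Flat words are treated apart because the gap position used for repeated
  words is guaranteed only for nonflat \<open>z\<close>.\<close>

lemma signed_sum_flat_factor:
  assumes "flat z" "w \<in> pwords" "\<not> flat w"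
  shows "(\<Sum>S\<in>Pow (Collect (word_reducible w)).
      (-1) ^ card S * of_bool (z \<le>\<^sub>g\<^sub>f lower w S)) = (0 :: int)"
proof -
  obtain i where i: "i < length w" "1 < w ! i"
    using assms(2,3) by (force simp: flat_iff pwords_iff)
  have "occurs_at z (lower w (insert i S)) k \<longleftrightarrow> occurs_at z (lower w S) k" if "i \<notin> S" for S k
    using that i assms(1) by (intro occurs_at_lower_insert) (auto simp: flat_iff)
  then show ?thesis
    using i by (intro sum_Pow_toggle_zero[of _ i])
      (auto simp: finite_word_reducible gf_le_iff_occurs word_reducible_def)
qed

lemma gf_le_flat:
  assumes "flat w" "z \<in> pwords" "z \<le>\<^sub>g\<^sub>f w"
  shows "flat z"
proof -
  obtain k where k: "occurs_at z w k" using assms(3) by (auto simp: gf_le_iff_occurs)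
  have "z ! j = 1" if "j < length z" for j
  proof -
    have "z ! j \<le> w ! (k + j)" "w ! (k + j) = 1" "0 < z ! j"
      using k that assms by (auto simp: occurs_at_def flat_iff pwords_iff)
    then show ?thesis by simp
  qed
  then show ?thesis by (simp add: flat_iff)
qed

text \<open>In a nonempty flat word of length \<open>n\<close> only the first letter is reducible,
  so for flat \<open>z\<close> the sum is the difference of the indicators of
  \<open>length z \<le> n\<close> and \<open>length z \<le> n - 1\<close>.\<close>

lemma signed_sum_flat:
  assumes w: "w \<in> pwords" "flat w" and z: "z \<in> pwords"
  shows "(\<Sum>S\<in>Pow (Collect (word_reducible w)).
      (-1) ^ card S * of_bool (z \<le>\<^sub>g\<^sub>f lower w S)) = (of_bool (z = w) :: int)"
proof (cases "w = []")
  case True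
  then have "Collect (word_reducible w) = {}" by (auto simp: word_reducible_def)
  then show ?thesis unfolding \<open>Collect (word_reducible w) = {}\<close> using True by (auto simp: gf_le_def)
next
  case False
  then have R: "Collect (word_reducible w) = {0}"
    using w by (auto simp: word_reducible_def flat_iff)
  define n where "n = length w"
  have n: "w = replicate n 1" "0 < n"
    using w False by (auto simp: n_def flat_iff intro!: nth_equalityI)
  have low: "lower w {0} = 0 # replicate (n - 1) 1"
    using n by (intro nth_equalityI) (auto simp: nth_Cons')
  have "z \<le>\<^sub>g\<^sub>f w \<longleftrightarrow> flat z \<and> length z \<le> n"
  proof
    assume "z \<le>\<^sub>g\<^sub>f w"
    then show "flat z \<and> length z \<le> n"
      using gf_le_flat w z gf_le_length n_def by blast
  next
    assume "flat z \<and> length z \<le> n"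
    then show "z \<le>\<^sub>g\<^sub>f w" unfolding n(1) gf_le_def by (auto simp: flat_iff intro!: exI[of _ 0])
  qed
  moreover have "z \<le>\<^sub>g\<^sub>f lower w {0} \<longleftrightarrow> flat z \<and> length z \<le> n - 1"
  proof
    assume a: "z \<le>\<^sub>g\<^sub>f lower w {0}"
    then obtain k where k: "occurs_at z (lower w {0}) k" by (auto simp: gf_le_iff_occurs)
    have "z ! j = 1" if "j < length z" for j
    proof -
      have "k + j < n" "z ! j \<le> lower w {0} ! (k + j)" "0 < z ! j"
        using k z that n(2) by (auto simp: low occurs_at_def pwords_iff)
      then show ?thesis by (auto simp: low nth_Cons' split: if_splits)
    qed
    then have "flat z" by (simp add: flat_iff)
    moreover have "length z \<le> n - 1"
    proof (rule ccontr)
      assume "\<not> ?thesis"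
      then have "k = 0" "z \<noteq> []" using k n(2) by (auto simp: low occurs_at_def)
      then have "z ! 0 \<le> 0" "0 < z ! 0" using k z by (auto simp: low occurs_at_def pwords_iff)
      then show False by simp
    qed
    ultimately show "flat z \<and> length z \<le> n - 1" by simp
  next
    assume "flat z \<and> length z \<le> n - 1"
    then show "z \<le>\<^sub>g\<^sub>f lower w {0}"
      unfolding low gf_le_def using n(2) by (auto simp: flat_iff intro!: exI[of _ 1])
  qed
  moreover have "z = w \<longleftrightarrow> flat z \<and> length z = n"
    using n(1) by (auto simp: flat_iff intro!: nth_equalityI)
  ultimately show ?thesis using n(2) unfolding R by (auto simp: Pow_insert)
qed

subsection \<open>Repeated factors and principal factors\<close>

text \<open>The overlap term of the inclusion-exclusion on occurrences. The positive occurrence need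
  not end with \<open>v\<close>; appending ones to \<open>z\<close> makes it do so.\<close>

definition repeated :: "nat list \<Rightarrow> nat list \<Rightarrow> bool" where
  "repeated z v \<longleftrightarrow> occurs_at z v 0 \<and> (\<exists>k>0. occurs_at z v k)"

text \<open>Comparing with \<open>max 1\<close> makes the position insensitive to ones appended to
  \<open>z\<close> and keeps the letter positive after lowering, so that no letter is
  deleted.\<close>

definition gap_index :: "nat list \<Rightarrow> nat list \<Rightarrow> nat" where
  "gap_index v z = (LEAST i. i < length v \<and> max 1 (letter0 z i) < v ! i)"

lemma gap_index_eqI:
  assumes "i < length v" "max 1 (letter0 z i) < v ! i"
    and "\<And>j. j < i \<Longrightarrow> v ! j \<le> max 1 (letter0 z j)"
  shows "gap_index v z = i"
  unfolding gap_index_def using assms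
  by (intro Least_equality) (auto simp: not_less[symmetric] simp del: max_less_iff_conj)

lemma gap_index:
  assumes "z \<in> pwords" "\<not> flat z" "repeated z v"
  shows "gap_index v z < length v" "max 1 (letter0 z (gap_index v z)) < v ! gap_index v z"
    and "j < gap_index v z \<Longrightarrow> v ! j \<le> max 1 (letter0 z j)"
proof -
  let ?P = "\<lambda>i. i < length v \<and> max 1 (letter0 z i) < v ! i"
  have ex: "\<exists>i. ?P i"
    using assms shifted_occurrence_gap unfolding repeated_def by blast
  have P: "?P (gap_index v z)" unfolding gap_index_def using ex by (rule LeastI_ex)
  then show "gap_index v z < length v" "max 1 (letter0 z (gap_index v z)) < v ! gap_index v z"
    by blast+
  assume j: "j < gap_index v z"
  then have "\<not> ?P j" unfolding gap_index_def by (rule not_less_Least)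
  then show "v ! j \<le> max 1 (letter0 z j)" using j P by linarith
qed

text \<open>Before the gap, a letter of \<open>v\<close> exceeding that of \<open>?p\<close> can
  only be a 1 beyond the end of \<open>?p\<close>. It is not first, since \<open>?p\<close> covers
  position 0, and not last, since the gap comes later; so it is not reducible. Hence the principal
  index is the same for all \<open>m\<close>.\<close>

lemma principal_index_eq_gap_index:
  assumes z: "z \<in> pwords" "\<not> flat z" and r: "repeated z v"
  shows "principal_index v (z @ replicate m 1) = gap_index v z"
  unfolding principal_index_def
proof (rule Least_equality)
  let ?p = "z @ replicate m 1" and ?i = "gap_index v z"
  note g = gap_index[OF z r]
  show "?i < length v \<and> letter0 ?p ?i < v ! ?i \<and> word_reducible v ?i"
    using g(1,2) letter0_append_ones(2)[of z m ?i] by (auto simp: word_reducible_def)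
  fix j assume j: "j < length v \<and> letter0 ?p j < v ! j \<and> word_reducible v j"
  show "?i \<le> j"
  proof (rule ccontr)
    assume "\<not> ?i \<le> j"
    then have le: "v ! j \<le> max 1 (letter0 z j)" "j < ?i" using g(3) by auto
    have "z \<noteq> []" using z(2) by (auto simp: flat_def)
    then have "j = 0 \<Longrightarrow> 0 < letter0 ?p j"
      using z(1) by (auto simp: letter0_def pwords_iff nth_append)
    moreover have "Suc j \<noteq> length v" using le(2) g(1) by simp
    ultimately have "1 < v ! j" using j by (auto simp: word_reducible_def)
    then show False using le(1) j letter0_append_ones(1)[of z j m] by auto
  qed
qed

section \<open>Trailing ones and primary prefixes\<close>

definition ones_stripped :: "nat list \<Rightarrow> nat list set" where
  "ones_stripped p = {x. \<exists>m. p = x @ replicate m 1}"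

lemma remove_ones_eq_Some: "remove_ones p m = Some x \<longleftrightarrow> p = x @ replicate m 1"
  by (auto simp: remove_ones_def)

lemma primary_prefixD:
  assumes "primary_prefix v p = Some x"
  shows "outer_factor x (word_reduce v (principal_index v p))" "x \<in> ones_stripped p"
proof -
  define ok where "ok = (\<lambda>m. 0 < m \<and>
    (\<exists>x. remove_ones p m = Some x \<and> outer_factor x (word_reduce v (principal_index v p))))"
  have "(if \<exists>m. ok m then remove_ones p (LEAST m. ok m) else None) = Some x"
    using assms unfolding primary_prefix_def ok_def Let_def .
  then have "\<exists>m. ok m" "remove_ones p (LEAST m. ok m) = Some x"
    by (auto split: if_splits)
  moreover from this have "ok (LEAST m. ok m)" by (metis LeastI_ex)
  ultimately show "outer_factor x (word_reduce v (principal_index v p))" unfolding ok_def by force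
  show "x \<in> ones_stripped p"
    using \<open>remove_ones p (LEAST m. ok m) = Some x\<close>
    unfolding remove_ones_eq_Some ones_stripped_def by blast
qed

text \<open>The primary prefix removes the fewest ones, so any outer factor \<open>y\<close> of the
  reduced word obtained by stripping \<open>p\<close> bounds the number removed.\<close>

lemma primary_prefix_exists:
  assumes "p = y @ replicate m 1" "0 < m"
    and "outer_factor y (word_reduce v (principal_index v p))"
  obtains x m' where "primary_prefix v p = Some x" "m' \<le> m" "p = x @ replicate m' 1"
proof -
  define ok where "ok = (\<lambda>m. 0 < m \<and>
    (\<exists>x. remove_ones p m = Some x \<and> outer_factor x (word_reduce v (principal_index v p))))"
  have pp: "primary_prefix v p = (if \<exists>m. ok m then remove_ones p (LEAST m. ok m) else None)"
    unfolding primary_prefix_def ok_def Let_def ..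
  have ok: "ok m" unfolding ok_def using assms remove_ones_eq_Some by blast
  then have "ok (LEAST m. ok m)" by (rule LeastI)
  then obtain x where x: "remove_ones p (LEAST m. ok m) = Some x" by (auto simp: ok_def)
  show thesis
  proof (rule that)
    show "primary_prefix v p = Some x" unfolding pp using ok x by auto
    show "(LEAST m. ok m) \<le> m" using ok by (rule Least_le)
    show "p = x @ replicate (LEAST m. ok m) 1" using x by (simp only: remove_ones_eq_Some)
  qed
qed

text \<open>This is \<open>T(v,p)\<close>, the words counted by \<open>\<nu>(u, p) - \<nu>(u, x(p))\<close>.\<close>

definition lost_factors :: "nat list \<Rightarrow> nat list \<Rightarrow> nat list set" where
  "lost_factors v p = ones_stripped p -
     (case primary_prefix v p of None \<Rightarrow> {} | Some x \<Rightarrow> ones_stripped x)"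

lemma ones_strippedD:
  assumes "z \<in> ones_stripped p" "p \<in> pwords" "\<not> flat p"
  shows "z \<in> pwords" "\<not> flat z" "z \<noteq> []"
  using assms by (auto simp: ones_stripped_def pwords_def flat_def)

lemma repeated_ones_stripped:
  assumes "outer_factor p v" "z \<in> ones_stripped p"
  shows "repeated z v"
proof -
  obtain m where "p = z @ replicate m 1" using assms(2) by (auto simp: ones_stripped_def)
  then have "occurs_at z v 0" "occurs_at z v (length v - length p)" "0 < length v - length p"
    using assms(1) by (auto simp: outer_factor_iff intro: occurs_at_appendD)
  then show ?thesis unfolding repeated_def by blast
qed

text \<open>The number of ones is the room left after the occurrence at \<open>k\<close>, so the
  padded word is a suffix starting exactly at \<open>k\<close>.\<close>

lemma outer_factor_of_occurrences:
  assumes "z \<in> pwords" "v \<in> pwords" "occurs_at z v 0" "occurs_at z v k" "0 < k"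
  shows "outer_factor (z @ replicate (length v - length z - k) 1) v"
proof -
  let ?m = "length v - length z - k"
  have l: "k + length z \<le> length v" using assms(4) by (simp add: occurs_at_def)
  then have k: "length v - length (z @ replicate ?m 1) = k" by simp
  have "z @ replicate ?m 1 \<in> pwords" using assms(1) by (auto simp: pwords_def)
  moreover have "occurs_at (z @ replicate ?m 1) v 0" "occurs_at (z @ replicate ?m 1) v k"
    by (rule occurs_at_append_ones; use assms l in simp)+
  ultimately show ?thesis
    unfolding outer_factor_iff k using l assms(5) by simp
qed

lemma occurs_at_decr:
  assumes "occurs_at z (v[i := v ! i - 1]) k"
  shows "occurs_at z v k"
  unfolding occurs_at_def
proof (intro conjI allI impI)
  show "k + length z \<le> length v" using assms by (simp add: occurs_at_def)
  fix j assume "j < length z"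
  then have "z ! j \<le> v[i := v ! i - 1] ! (k + j)" "k + j < length v"
    using assms by (auto simp: occurs_at_def)
  then show "z ! j \<le> v ! (k + j)" by (cases "i = k + j") auto
qed

lemma word_reduce_gap_index:
  assumes "z \<in> pwords" "\<not> flat z" "repeated z v"
  shows "word_reduce v (gap_index v z) = v[gap_index v z := v ! gap_index v z - 1]"
  using gap_index(2)[OF assms] by (auto simp: word_reduce_def)

lemma decr_gap_pwords:
  assumes "z \<in> pwords" "\<not> flat z" "repeated z v" "v \<in> pwords"
  shows "v[gap_index v z := v ! gap_index v z - 1] \<in> pwords"
  using gap_index(1,2)[OF assms(1-3)] assms(4) by (auto simp: pwords_iff nth_list_update)

text \<open>If \<open>z\<close> is still repeated after the lowering, padding it with
  \<open>?j\<close> ones gives an outer factor of both words. Maximality of \<open>p\<close> forces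
  \<open>?j \<le> m\<close>, and \<open>?j = m\<close> would keep \<open>p\<close> a suffix; so
  \<open>?j < m\<close>, the padded word competes for the primary prefix, and \<open>z\<close> is a
  stripping of the latter. Conversely, strippings of the primary prefix are repeated because it is
  an outer factor of the reduced word.\<close>

lemma lost_factors_iff:
  assumes v: "v \<in> pwords" and p: "principal_factor p v" and z: "z \<in> ones_stripped p"
  defines "i \<equiv> gap_index v z"
  shows "z \<in> lost_factors v p \<longleftrightarrow> \<not> repeated z (v[i := v ! i - 1])"
proof -
  let ?v' = "v[i := v ! i - 1]"
  have p': "outer_factor p v" "p \<in> pwords" "\<not> flat p"
    using p by (auto simp: principal_factor_def maximal_outer_factor_def outer_factor_def)
  note z' = ones_strippedD[OF z p'(2,3)]
  have r: "repeated z v" using repeated_ones_stripped p'(1) z by blast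
  obtain m where m: "p = z @ replicate m 1" using z by (auto simp: ones_stripped_def)
  have red: "word_reduce v (principal_index v p) = ?v'"
    unfolding m principal_index_eq_gap_index[OF z'(1,2) r] i_def
    by (rule word_reduce_gap_index[OF z'(1,2) r])
  have v': "?v' \<in> pwords" unfolding i_def using decr_gap_pwords z' r v by blast
  show ?thesis
  proof
    assume T: "z \<in> lost_factors v p"
    show "\<not> repeated z ?v'"
    proof
      assume "repeated z ?v'"
      then obtain k where k: "occurs_at z ?v' 0" "occurs_at z ?v' k" "0 < k"
        by (auto simp: repeated_def)
      let ?j = "length v - length z - k"
      let ?y = "z @ replicate ?j 1"
      have y: "outer_factor ?y ?v'" "outer_factor ?y v"
        using outer_factor_of_occurrences[OF z'(1) v' k]
          outer_factor_of_occurrences[OF z'(1) v occurs_at_decr[OF k(1)] occurs_at_decr[OF k(2)] k(3)]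
        by simp_all
      have "?j \<le> m"
      proof (rule ccontr)
        assume j: "\<not> ?j \<le> m"
        then have "replicate ?j (1::nat) = replicate m 1 @ replicate (?j - m) 1"
          by (simp flip: replicate_add)
        then have "p \<le>\<^sub>g\<^sub>f ?y"
          unfolding m gf_le_iff_occurs by (auto simp: occurs_at_def nth_append intro!: exI[of _ 0])
        moreover have "length p < length ?y" using j m by simp
        ultimately show False
          using p y(2) by (auto simp: principal_factor_def maximal_outer_factor_def)
      qed
      moreover have "?j \<noteq> m"
      proof
        assume "?j = m"
        then have "gf_suffix p ?v'" using y(1) m by (simp add: outer_factor_def)
        then show False using p red by (simp add: principal_factor_def)
      qed
      ultimately have "0 < m - ?j" "p = ?y @ replicate (m - ?j) 1"
        using m by (auto simp flip: replicate_add)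
      then obtain x m' where x: "primary_prefix v p = Some x" "m' \<le> m - ?j" "p = x @ replicate m' 1"
        using primary_prefix_exists[of p ?y "m - ?j" v] y(1) unfolding red by blast
      have "z @ replicate m 1 = (z @ replicate (m - m') 1) @ replicate m' 1"
        using x(2) by (simp flip: replicate_add)
      then have "x = z @ replicate (m - m') 1" using x(3) m by simp
      then show False using T x(1) by (auto simp: lost_factors_def ones_stripped_def)
    qed
  next
    assume nr: "\<not> repeated z ?v'"
    have "z \<notin> ones_stripped x" if "primary_prefix v p = Some x" for x
      using primary_prefixD(1)[OF that] repeated_ones_stripped nr red by auto
    then show "z \<in> lost_factors v p"
      using z by (auto simp: lost_factors_def split: option.split)
  qed
qed

section \<open>Bases as lowered words\<close>

lemma lower_lowered:
  assumes "is_base v w"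
  shows "lower w (lowered v w) = v @ replicate (length w - length v) 0"
proof (rule nth_equalityI)
  show l: "length (lower w (lowered v w)) = length (v @ replicate (length w - length v) 0)"
    using assms by (auto simp: is_base_def)
  fix i assume "i < length (lower w (lowered v w))"
  then have i: "i < length w" by simp
  then have "letter0 v i = w ! i \<or> letter0 v i = w ! i - 1" using assms by (auto simp: is_base_def)
  then have "lower w (lowered v w) ! i = letter0 v i" using i by (auto simp: lowered_def)
  then show "lower w (lowered v w) ! i = (v @ replicate (length w - length v) 0) ! i"
    using i by (auto simp: letter0_def nth_append)
qed

lemma repeated_append_zeros:
  "z \<in> pwords \<Longrightarrow> z \<noteq> [] \<Longrightarrow> repeated z (v @ replicate c 0) \<longleftrightarrow> repeated z v"
  by (simp add: repeated_def occurs_at_append_zeros)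

lemma finite_lowered: "finite (lowered v w)"
  by (rule finite_subset[of _ "{..<length w}"]) (auto simp: lowered_def)

lemma less_base_ell_iff:
  assumes "i < length w"
  shows "i < base_ell v w \<longleftrightarrow> (\<forall>j\<in>lowered v w. i < j)"
proof (cases "lowered v w = {}")
  case True
  then show ?thesis using assms by (simp add: base_ell_def base_degree_def)
next
  case False
  then have "base_ell v w = (LEAST j. j \<in> lowered v w)"
    using finite_lowered by (simp add: base_ell_def base_degree_def)
  moreover have "(LEAST j. j \<in> lowered v w) \<in> lowered v w" using False by (metis LeastI ex_in_conv)
  moreover have "\<And>j. j \<in> lowered v w \<Longrightarrow> (LEAST j. j \<in> lowered v w) \<le> j" by (rule Least_le)
  ultimately show ?thesis by (metis order_less_le_trans)
qed

text \<open>A base has positive letters, so a lowered 1 can only be the dropped last letter of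
  \<open>w\<close>, which is reducible as \<open>w\<close> is not flat.\<close>

lemma lowered_reducible:
  assumes "is_base v w" "w \<in> pwords" "\<not> flat w"
  shows "lowered v w \<subseteq> Collect (word_reducible w)"
proof
  fix j assume j: "j \<in> lowered v w"
  then have jw: "j < length w" "letter0 v j = w ! j - 1" by (auto simp: lowered_def)
  have "0 < w ! j" using assms(2) jw by (simp add: pwords_iff)
  moreover have "Suc j = length w" if "w ! j = 1"
  proof -
    have "letter0 v j = 0" using jw that by simp
    then have "\<not> j < length v" using assms(1) by (auto simp: letter0_def is_base_def pwords_iff)
    then show ?thesis using jw assms(1) by (auto simp: is_base_def)
  qed
  ultimately show "j \<in> Collect (word_reducible w)"
    using assms(3) jw(1) by (auto simp: word_reducible_def)
qed

text \<open>The degree is determined by the base and is therefore dropped from the index set of the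
  sum.\<close>

definition principal_pairs :: "nat list \<Rightarrow> (nat list \<times> nat list) set" where
  "principal_pairs w = {(v, p). \<exists>i. principal_factor_deg p w i v}"

lemma principal_pairs_iff:
  "(v, p) \<in> principal_pairs w \<longleftrightarrow>
     is_base v w \<and> principal_factor p v \<and> principal_index v p < base_ell v w"
  by (simp add: principal_pairs_def principal_factor_deg_def)

lemma base_gf_le:
  assumes "is_base v w" "w \<in> pwords"
  shows "v \<le>\<^sub>g\<^sub>f w"
proof -
  have "v ! j \<le> w ! j" if "j < length v" for j
  proof -
    have "j < length w" using that assms(1) by (auto simp: is_base_def)
    then have "letter0 v j = w ! j \<or> letter0 v j = w ! j - 1" using assms(1) by (auto simp: is_base_def)
    then show ?thesis using that by (auto simp: letter0_def)
  qed
  then show ?thesis using assms(1) by (auto simp: gf_le_def is_base_def intro!: exI[of _ 0])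
qed

lemma principal_factor_gf_le:
  assumes "principal_factor p v"
  shows "p \<le>\<^sub>g\<^sub>f v"
  using assms by (auto simp: principal_factor_def maximal_outer_factor_def outer_factor_iff gf_le_iff_occurs)

lemma finite_principal_pairs: "w \<in> pwords \<Longrightarrow> finite (principal_pairs w)"
  by (rule finite_subset[of _ "{z. z \<le>\<^sub>g\<^sub>f w} \<times> {z. z \<le>\<^sub>g\<^sub>f w}"])
    (auto simp: finite_gf_le principal_pairs_iff
      intro: base_gf_le gf_le_trans[OF principal_factor_gf_le base_gf_le])

section \<open>Pairs (v, p) against sets of lowered positions\<close>

lemma repeated_mono:
  "repeated z (lower w T) \<Longrightarrow> S \<subseteq> T \<Longrightarrow> repeated z (lower w S)"
  unfolding repeated_def using occurs_at_lower_mono by blast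

text \<open>The principal index lies below every lowered position, so \<open>v\<close> and
  \<open>w\<close> agree up to it and have the same gap for \<open>z\<close>. Lowering the gap in
  \<open>v\<close> thus amounts to adding it to \<open>S\<close>, and
  \<open>lost_factors_iff\<close> applies.\<close>

lemma lowered_of_lost_pair:
  assumes w: "w \<in> pwords" and vp: "(v, p) \<in> principal_pairs w" and zT: "z \<in> lost_factors v p"
  defines "S \<equiv> lowered v w"
  shows "S \<subseteq> Collect (word_reducible w)" "gap_index w z \<notin> S"
    and "repeated z (lower w S)" "\<not> repeated z (lower w (insert (gap_index w z) S))"
proof -
  let ?i = "gap_index v z" and ?c = "length w - length v"
  have b: "is_base v w" and p: "principal_factor p v" and ell: "principal_index v p < base_ell v w"
    using vp by (auto simp: principal_pairs_iff)
  have v: "v \<in> pwords" using b by (simp add: is_base_def)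
  have z: "z \<in> ones_stripped p" using zT by (simp add: lost_factors_def)
  have p': "outer_factor p v" "p \<in> pwords" "\<not> flat p"
    using p by (auto simp: principal_factor_def maximal_outer_factor_def outer_factor_def)
  note z' = ones_strippedD[OF z p'(2,3)]
  have r: "repeated z v" using repeated_ones_stripped p'(1) z by blast
  note g = gap_index[OF z'(1,2) r]
  obtain m where m: "p = z @ replicate m 1" using z by (auto simp: ones_stripped_def)
  have iw: "?i < length w" using g(1) b by (auto simp: is_base_def)
  have S: "\<forall>j\<in>S. ?i < j"
    using ell less_base_ell_iff[OF iw] unfolding m principal_index_eq_gap_index[OF z'(1,2) r] S_def
    by simp
  have low: "lower w S = v @ replicate ?c 0" unfolding S_def by (rule lower_lowered[OF b])
  have agree: "v ! j = w ! j" if "j \<le> ?i" for j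
  proof -
    have "lower w S ! j = w ! j" using S that iw by auto
    then show ?thesis using low that g(1) by (simp add: nth_append)
  qed
  have gw: "gap_index w z = ?i"
    using iw g(2,3) agree by (intro gap_index_eqI) auto
  have "\<not> flat w"
  proof
    assume "flat w"
    then have "flat z"
      using gf_le_flat[of v z] gf_le_flat[of w v] v w z'(1) base_gf_le[OF b w] r
      by (auto simp: repeated_def gf_le_iff_occurs)
    then show False using z'(2) by simp
  qed
  then show "S \<subseteq> Collect (word_reducible w)" unfolding S_def using lowered_reducible b w by blast
  show "gap_index w z \<notin> S" unfolding gw using S by blast
  show "repeated z (lower w S)" unfolding low using repeated_append_zeros z' r by blast
  have "?i \<notin> S" using S by blast
  then have "lower w (insert ?i S) = (v[?i := v ! ?i - 1]) @ replicate ?c 0"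
    using lower_insert[of ?i S w] iw low agree[of ?i] g(1) by (simp add: list_update_append)
  then show "\<not> repeated z (lower w (insert (gap_index w z) S))"
    unfolding gw using repeated_append_zeros z' lost_factors_iff[OF v p z] zT by simp
qed

text \<open>The base is \<open>lower w S\<close> without a final zero; the factor is
  \<open>z\<close> padded with ones from its first positive occurrence, which makes it as long as
  possible.\<close>

lemma lost_pair_of_lowered:
  assumes w: "w \<in> pwords" and z: "z \<in> pwords" "\<not> flat z"
    and S: "S \<subseteq> Collect (word_reducible w)" "gap_index w z \<notin> S"
    and r: "repeated z (lower w S)" "\<not> repeated z (lower w (insert (gap_index w z) S))"
  shows "\<exists>v p. (v, p) \<in> principal_pairs w \<and> z \<in> lost_factors v p \<and> lowered v w = S"
proof -
  let ?i = "gap_index w z"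
  define \<eta> where "\<eta> = lower w S"
  have z0: "z \<noteq> []" using z by (auto simp: flat_def)
  have z00: "0 < z ! 0" using z z0 by (simp add: pwords_iff)
  have rw: "repeated z w" using repeated_mono[OF r(1), of "{}"] by simp
  note g = gap_index[OF z rw]
  have occ0: "z ! j \<le> \<eta> ! j" if "j < length z" for j
    using r(1) that by (auto simp: repeated_def occurs_at_def \<eta>_def)
  have len: "length \<eta> = length w" by (simp add: \<eta>_def)
  have zw: "length z \<le> length w" using rw by (simp add: repeated_def occurs_at_def)
  \<comment> \<open>Lowering before the gap would destroy the prefix occurrence of \<open>z\<close>:
    a letter above 1 there is at most the letter of \<open>z\<close>, and a reducible 1 there is the
    first letter, which faces the positive first letter of \<open>z\<close>.\<close>
  have above: "?i < j" if j: "j \<in> S" for j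
  proof (rule ccontr)
    assume "\<not> ?i < j"
    then have ji: "j < ?i" using S(2) j by (metis linorder_neqE_nat)
    have jr: "word_reducible w j" "j < length w" using S(1) j by (auto simp: word_reducible_def)
    have \<eta>j: "\<eta> ! j = w ! j - 1" using j jr by (simp add: \<eta>_def)
    have "Suc j \<noteq> length w" using ji g(1) by simp
    then consider "1 < w ! j" | "j = 0" "w ! j = 1" using jr by (auto simp: word_reducible_def)
    then show False
    proof cases
      case 1
      then have "w ! j \<le> letter0 z j" using g(3)[OF ji] by auto
      then have "j < length z" "w ! j \<le> z ! j" using 1 by (auto simp: letter0_def split: if_splits)
      then show False using occ0[of j] \<eta>j 1 by simp
    next
      case 2
      then show False using occ0[of 0] z0 z00 \<eta>j by simp
    qed
  qed
  \<comment> \<open>Only the last letter can be 0 here, because \<open>above\<close> keeps position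
    0 out of \<open>S\<close> and an inner 1 is not reducible.\<close>
  define v where "v = (if last \<eta> = 0 then butlast \<eta> else \<eta>)"
  have \<eta>0: "\<eta> \<noteq> []" using zw z0 len by auto
  have split: "\<eta> = v @ replicate (length w - length v) 0"
  proof (cases "last \<eta> = 0")
    case True
    moreover have "length w - (length \<eta> - 1) = 1" using \<eta>0 len by (cases \<eta>) auto
    ultimately show ?thesis
      using append_butlast_last_id[OF \<eta>0] by (simp add: v_def del: append_butlast_last_id)
  qed (simp add: v_def len)
  have lv: "length v = length w \<or> Suc (length v) = length w" using \<eta>0 len by (cases \<eta>) (auto simp: v_def)
  have vn: "v ! j = \<eta> ! j" if "j < length v" for j using split that by (metis nth_append)
  have v: "v \<in> pwords"
    unfolding pwords_iff
  proof (intro allI impI)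
    fix j assume j: "j < length v"
    then have jw: "j < length w" using lv by auto
    have "0 < w ! j" using w jw by (simp add: pwords_iff)
    moreover have False if "j \<in> S" "w ! j = 1"
    proof -
      have "j \<noteq> 0" using above[OF that(1)] by simp
      then have jl: "Suc j = length w" using that S(1) by (auto simp: word_reducible_def)
      then have "last \<eta> = \<eta> ! j" using \<eta>0 len by (simp add: last_conv_nth flip: jl)
      then have "last \<eta> = 0" using that jw by (simp add: \<eta>_def)
      then show False using j jl len by (simp add: v_def)
    qed
    ultimately show "0 < v ! j"
      using jw vn[OF j] by (cases "w ! j = 1") (auto simp: \<eta>_def)
  qed
  have l0: "letter0 v j = \<eta> ! j" if "j < length w" for j
  proof (cases "j < length v")
    case True
    then show ?thesis using vn by (simp add: letter0_def)
  next
    case False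
    then have "\<eta> ! j = 0" using split that by (metis linorder_not_less nth_append nth_replicate diff_less_mono)
    then show ?thesis using False by (simp add: letter0_def)
  qed
  have b: "is_base v w"
    unfolding is_base_def using v lv l0 by (auto simp: \<eta>_def)
  have low: "lowered v w = S"
  proof -
    have "letter0 v j = w ! j - 1 \<longleftrightarrow> j \<in> S" if "j < length w" for j
    proof -
      have "0 < w ! j" using w that by (simp add: pwords_iff)
      then show ?thesis using l0[OF that] that by (auto simp: \<eta>_def)
    qed
    then show ?thesis using S(1) by (auto simp: lowered_def word_reducible_def)
  qed
  have rv: "repeated z v"
    using r(1) split repeated_append_zeros[OF z(1) z0] by (simp add: \<eta>_def)
  have iv: "?i < length v"
  proof (rule ccontr)
    assume "\<not> ?thesis"
    then have "letter0 v ?i = 0" by (simp add: letter0_def)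
    then show False using l0[OF g(1)] g(1,2) S(2) by (auto simp: \<eta>_def)
  qed
  have agree: "v ! j = w ! j" if "j \<le> ?i" for j
  proof -
    have "j \<notin> S" using above[of j] that by auto
    then show ?thesis using vn[of j] that iv g(1) by (simp add: \<eta>_def)
  qed
  have gv: "gap_index v z = ?i"
    using iv g(2,3) agree by (intro gap_index_eqI) auto
  let ?v' = "v[?i := v ! ?i - 1]"
  have "lower w (insert ?i S) = ?v' @ replicate (length w - length v) 0"
    using lower_insert[OF S(2) g(1)] split agree[of ?i] iv
    by (simp add: list_update_append \<eta>_def)
  then have nr: "\<not> repeated z ?v'"
    using r(2) repeated_append_zeros[OF z(1) z0] by simp
  \<comment> \<open>The least positive position leaves the most room for ones, hence the longest
    padded word.\<close>
  define k where "k = (LEAST k. 0 < k \<and> occurs_at z v k)"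
  have k: "0 < k" "occurs_at z v k"
    using LeastI_ex[of "\<lambda>k. 0 < k \<and> occurs_at z v k"] rv by (auto simp: k_def repeated_def)
  have kmin: "k \<le> k'" if "0 < k'" "occurs_at z v k'" for k'
    unfolding k_def using that by (intro Least_le) simp
  define p where "p = z @ replicate (length v - length z - k) 1"
  have zv: "occurs_at z v 0" "k + length z \<le> length v" using rv k by (auto simp: repeated_def occurs_at_def)
  have lp: "length p = length v - k" using zv(2) by (simp add: p_def)
  have out: "outer_factor p v"
    unfolding p_def using outer_factor_of_occurrences z(1) v zv(1) k by blast
  have max: "maximal_outer_factor p v"
    unfolding maximal_outer_factor_def
  proof (intro conjI out notI)
    assume "\<exists>q. outer_factor q v \<and> length p < length q \<and> p \<le>\<^sub>g\<^sub>f q"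
    then obtain q k' where q: "outer_factor q v" "length p < length q" "occurs_at p q k'"
      by (auto simp: gf_le_iff_occurs)
    \<comment> \<open>An outer factor \<open>q\<close> containing \<open>p\<close> at offset
      \<open>k'\<close> yields two occurrences of \<open>z\<close> in \<open>v\<close>, through
      \<open>q\<close> as a prefix and as a suffix. If \<open>k'\<close> is 0 the second, otherwise
      the first, is positive and smaller than \<open>k\<close>.\<close>
    have zq: "occurs_at z q k'" using q(3) unfolding p_def by (rule occurs_at_appendD)
    have o: "occurs_at z v k'" "occurs_at z v (length v - length q + k')" "length q < length v"
      using occurs_at_trans[OF zq, of v 0] occurs_at_trans[OF zq, of v "length v - length q"] q(1)
      by (auto simp: outer_factor_iff)
    have k': "k' + length p \<le> length q" using q(3) by (simp add: occurs_at_def)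
    show False
    proof (cases "k' = 0")
      case True
      then show False using kmin[OF _ o(2)] o(3) q(2) lp zv(2) by simp
    next
      case False
      then show False using kmin[OF _ o(1)] k' o(3) lp zv(2) by simp
    qed
  qed
  have zp: "z \<in> ones_stripped p" by (auto simp: ones_stripped_def p_def)
  have pi: "principal_index v p = ?i"
    unfolding p_def using principal_index_eq_gap_index[OF z rv] gv by simp
  have red: "word_reduce v ?i = ?v'"
    using word_reduce_gap_index[OF z rv] gv by simp
  \<comment> \<open>At the gap \<open>v\<close> exceeds \<open>z\<close>, so the prefix occurrence
    survives the lowering; a surviving suffix \<open>p\<close> would give a second occurrence and
    make \<open>z\<close> repeated.\<close>
  have "\<not> gf_suffix p ?v'"
  proof
    assume s: "gf_suffix p ?v'"
    have "occurs_at z (v[?i := v ! ?i - 1]) 0"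
      unfolding occurs_at_def
    proof (intro conjI allI impI)
      show "0 + length z \<le> length (v[?i := v ! ?i - 1])" using zv(2) by simp
      fix j assume j: "j < length z"
      then have "z ! j \<le> v ! j" using zv(1) by (simp add: occurs_at_def)
      moreover have "z ! j < v ! ?i" if "j = ?i"
        using g(2) agree[of ?i] that j by (auto simp: letter0_def)
      ultimately show "z ! j \<le> v[?i := v ! ?i - 1] ! (0 + j)"
        using j zv(2) iv by (cases "j = ?i") auto
    qed
    moreover have "occurs_at p ?v' (length v - length p)" using s by (simp add: gf_suffix_iff)
    then have "occurs_at z ?v' (length v - length p)" unfolding p_def by (rule occurs_at_appendD)
    moreover have "0 < length v - length p" using out by (simp add: outer_factor_def)
    ultimately show False using nr unfolding repeated_def by blast
  qed
  then have pf: "principal_factor p v"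
    using max z(2) pi red by (auto simp: principal_factor_def flat_def p_def)
  have "(v, p) \<in> principal_pairs w"
    using b pf pi low above less_base_ell_iff[OF g(1)] by (simp add: principal_pairs_iff)
  moreover have "z \<in> lost_factors v p"
    using lost_factors_iff[OF v pf zp] nr gv by simp
  ultimately show ?thesis using low by blast
qed

text \<open>Deleting zeros from the common lowered word recovers the base. Two distinct paddings of
  \<open>z\<close> by ones cannot both be maximal outer factors of it, since the shorter one is
  contained in the longer.\<close>

lemma lost_pair_unique:
  assumes "(v, p) \<in> principal_pairs w" "z \<in> lost_factors v p"
    and "(v', p') \<in> principal_pairs w" "z \<in> lost_factors v' p'"
    and "lowered v w = lowered v' w"
  shows "v = v' \<and> p = p'"
proof -
  have b: "is_base v w" "is_base v' w" and pf: "principal_factor p v" "principal_factor p' v'"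
    using assms by (auto simp: principal_pairs_iff)
  have "v @ replicate (length w - length v) 0 = v' @ replicate (length w - length v') 0"
    using lower_lowered[OF b(1)] lower_lowered[OF b(2)] assms(5) by simp
  then have "filter (\<lambda>a. a \<noteq> 0) (v @ replicate (length w - length v) 0) =
      filter (\<lambda>a. a \<noteq> 0) (v' @ replicate (length w - length v') 0)" by simp
  moreover have "filter (\<lambda>a. a \<noteq> 0) v = v" "filter (\<lambda>a. a \<noteq> 0) v' = v'"
    using b by (auto simp: is_base_def pwords_def filter_id_conv)
  ultimately have vv: "v = v'" by (simp add: filter_replicate)
  obtain m m' where m: "p = z @ replicate m 1" "p' = z @ replicate m' 1"
    using assms(2,4) by (auto simp: lost_factors_def ones_stripped_def)
  have *: "\<not> a < a'" if "maximal_outer_factor (z @ replicate a 1) v" "outer_factor (z @ replicate a' 1) v"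
    for a a'
  proof
    assume "a < a'"
    then have "z @ replicate a 1 \<le>\<^sub>g\<^sub>f z @ replicate a' 1"
      by (auto simp: gf_le_iff_occurs occurs_at_def nth_append intro!: exI[of _ 0])
    then show False using that \<open>a < a'\<close> by (auto simp: maximal_outer_factor_def)
  qed
  have "m = m'"
    using *[of m m'] *[of m' m] pf vv m
    by (auto simp: principal_factor_def maximal_outer_factor_def)
  then show ?thesis using vv m by simp
qed

text \<open>Toggling the gap leaves the sets \<open>S\<close> for which \<open>z\<close> is repeated
  but ceases to be so once the gap is lowered. The map \<open>lowered\<close> matches the pairs that
  lose \<open>z\<close> with these sets, and the degree of the base is
  \<open>card S\<close>.\<close>

lemma signed_sum_repeated:
  assumes w: "w \<in> pwords" and z: "z \<in> pwords" "\<not> flat z"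
  shows "(\<Sum>S\<in>Pow (Collect (word_reducible w)).
      (-1) ^ card S * of_bool (repeated z (lower w S))) =
    (\<Sum>(v, p)\<in>principal_pairs w. (-1) ^ base_degree v w * (of_bool (z \<in> lost_factors v p) :: int))"
proof -
  let ?R = "Collect (word_reducible w)" and ?i = "gap_index w z"
  let ?A = "{S \<in> Pow (?R - {?i}). repeated z (lower w S) \<and> \<not> repeated z (lower w (insert ?i S))}"
  let ?B = "{(v, p) \<in> principal_pairs w. z \<in> lost_factors v p}"
  have bij: "bij_betw (\<lambda>(v, p). lowered v w) ?B ?A"
  proof (rule bij_betwI')
    fix x y assume "x \<in> ?B" "y \<in> ?B"
    then show "(case x of (v, p) \<Rightarrow> lowered v w) = (case y of (v, p) \<Rightarrow> lowered v w) \<longleftrightarrow> x = y"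
      using lost_pair_unique[of "fst x" "snd x" w z "fst y" "snd y"]
      by (auto simp: case_prod_beta prod_eq_iff)
  next
    fix x assume "x \<in> ?B"
    then show "(case x of (v, p) \<Rightarrow> lowered v w) \<in> ?A"
      using lowered_of_lost_pair[OF w] by (cases x) auto
  next
    fix S assume "S \<in> ?A"
    then show "\<exists>x\<in>?B. S = (case x of (v, p) \<Rightarrow> lowered v w)"
      using lost_pair_of_lowered[OF w z, of S] by fastforce
  qed
  have "(\<Sum>S\<in>Pow ?R. (-1) ^ card S * of_bool (repeated z (lower w S))) =
      (\<Sum>S\<in>?A. (-1::int) ^ card S)"
  proof (cases "repeated z w")
    case True
    then have iR: "?i \<in> ?R" using gap_index(1,2)[OF z] by (auto simp: word_reducible_def)
    \<comment> \<open>Being repeated is inherited by smaller sets, so the difference is itself an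
      indicator.\<close>
    have "(of_bool (repeated z (lower w S)) - of_bool (repeated z (lower w (insert ?i S))) :: int) =
        of_bool (repeated z (lower w S) \<and> \<not> repeated z (lower w (insert ?i S)))" for S
      using repeated_mono[of z w "insert ?i S" S] by auto
    then have "(\<Sum>S\<in>Pow ?R. (-1) ^ card S * of_bool (repeated z (lower w S))) =
      (\<Sum>S\<in>Pow (?R - {?i}). (-1::int) ^ card S *
        of_bool (repeated z (lower w S) \<and> \<not> repeated z (lower w (insert ?i S))))"
      unfolding sum_Pow_toggle[OF finite_word_reducible iR] by simp
    also have "\<dots> = (\<Sum>S\<in>?A. (-1) ^ card S)"
      using finite_word_reducible[of w]
      by (simp add: sum.inter_filter of_bool_def del: Pow_iff de_Morgan_conj) (intro sum.cong; simp)
    finally show ?thesis .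
  next
    case False
    then have n: "\<not> repeated z (lower w S)" for S
      using repeated_mono[of z w S "{}"] by auto
    then have A: "?A = {}" by blast
    show ?thesis unfolding A using n by simp
  qed
  also have "\<dots> = (\<Sum>x\<in>?B. (-1) ^ card (case x of (v, p) \<Rightarrow> lowered v w))"
    by (rule sum.reindex_bij_betw[OF bij, symmetric])
  also have "\<dots> = (\<Sum>(v, p)\<in>?B. (-1) ^ base_degree v w)"
    by (auto intro!: sum.cong simp: base_degree_def)
  also have "\<dots> = (\<Sum>(v, p)\<in>principal_pairs w.
      (-1) ^ base_degree v w * of_bool (z \<in> lost_factors v p))"
  proof -
    have B: "?B = {x \<in> principal_pairs w. z \<in> lost_factors (fst x) (snd x)}" by auto
    have "(\<Sum>x\<in>?B. (-1::int) ^ base_degree (fst x) w) = (\<Sum>x\<in>principal_pairs w.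
        if z \<in> lost_factors (fst x) (snd x) then (-1) ^ base_degree (fst x) w else 0)"
      unfolding B by (rule sum.inter_filter[OF finite_principal_pairs[OF w]])
    also have "\<dots> = (\<Sum>x\<in>principal_pairs w.
        (-1) ^ base_degree (fst x) w * of_bool (z \<in> lost_factors (fst x) (snd x)))"
      by (rule sum.cong) simp_all
    finally show ?thesis by (simp only: case_prod_unfold)
  qed
  finally show ?thesis .
qed

subsection \<open>Padded words\<close>

definition strip :: "nat list \<Rightarrow> nat list" where
  "strip \<eta> = filter (\<lambda>a. a \<noteq> 0) \<eta>"

definition contiguous :: "nat list \<Rightarrow> bool" where
  "contiguous \<eta> \<longleftrightarrow> (\<exists>a b. \<eta> = replicate a 0 @ strip \<eta> @ replicate b 0)"

lemma strip_in_pwords [simp]: "strip \<eta> \<in> pwords"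
  by (auto simp: strip_def pwords_def)

lemma strip_pad: "v \<in> pwords \<Longrightarrow> strip (replicate a 0 @ v @ replicate b 0) = v"
  by (auto simp: strip_def pwords_def filter_id_conv)

lemma strip_pwords: "v \<in> pwords \<Longrightarrow> strip v = v"
  using strip_pad[of v 0 0] by simp

lemma contiguous_pad: "v \<in> pwords \<Longrightarrow> contiguous (replicate a 0 @ v @ replicate b 0)"
  unfolding contiguous_def strip_pad by blast

lemma contiguous_pwords: "v \<in> pwords \<Longrightarrow> contiguous v"
  using contiguous_pad[of v 0 0] by simp

lemma sum_list_strip: "sum_list (strip \<eta>) = sum_list \<eta>"
  by (induction \<eta>) (auto simp: strip_def)

text \<open>Letters of a word are positive, so an occurrence never touches the padding and is only
  shifted by it.\<close>

lemma gf_le_strip: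
  assumes "contiguous \<eta>" "z \<in> pwords"
  shows "z \<le>\<^sub>g\<^sub>f strip \<eta> \<longleftrightarrow> z \<le>\<^sub>g\<^sub>f \<eta>"
proof (cases "z = []")
  case True
  then show ?thesis by (simp add: gf_le_def) (metis le0)
next
  case False
  obtain a b where \<eta>: "\<eta> = (replicate a 0 @ strip \<eta>) @ replicate b 0"
    using assms(1) by (auto simp: contiguous_def)
  let ?v = "strip \<eta>"
  have "(\<exists>k. occurs_at z (replicate a 0 @ ?v) k) \<longleftrightarrow> (\<exists>k. occurs_at z ?v k)"
  proof
    assume "\<exists>k. occurs_at z (replicate a 0 @ ?v) k"
    then obtain k where k: "occurs_at z (replicate a 0 @ ?v) k" by blast
    then have "z ! 0 \<le> (replicate a 0 @ ?v) ! (k + 0)" using False unfolding occurs_at_def by blast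
    moreover have "0 < z ! 0" using assms(2) False by (simp add: pwords_iff)
    ultimately have "a \<le> k" by (auto simp: nth_append not_less[symmetric] split: if_splits)
    then have "occurs_at z ?v (k - a)" using k by (auto simp: occurs_at_def nth_append)
    then show "\<exists>k. occurs_at z ?v k" by blast
  next
    assume "\<exists>k. occurs_at z ?v k"
    then obtain k where "occurs_at z ?v k" by blast
    then have "occurs_at z (replicate a 0 @ ?v) (a + k)" by (auto simp: occurs_at_def nth_append)
    then show "\<exists>k. occurs_at z (replicate a 0 @ ?v) k" by blast
  qed
  then show ?thesis
    unfolding gf_le_iff_occurs using occurs_at_append_zeros[OF assms(2) False] \<eta> by metis
qed

subsection \<open>Reductions of words\<close>

lemma nth_word_reduce: "j < i \<Longrightarrow> i < length v \<Longrightarrow> word_reduce v i ! j = v ! j"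
  by (auto simp: word_reduce_def nth_append)

lemma length_word_reduce:
  "i < length v \<Longrightarrow> length (word_reduce v i) = (if v ! i = 1 then length v - 1 else length v)"
  by (auto simp: word_reduce_def)

lemma emb_reducible_pad:
  assumes v: "v \<in> pwords"
  shows "emb_reducible (replicate a 0 @ v @ replicate b 0) v i \<longleftrightarrow>
    (\<exists>j. i = a + j \<and> word_reducible v j)"
proof (cases "a \<le> i \<and> i < a + length v")
  case True
  let ?\<eta> = "replicate a 0 @ v @ replicate b 0"
  define j where "j = i - a"
  have i: "i = a + j" "j < length v" using True by (auto simp: j_def)
  have nth: "?\<eta> ! (a + k) = v ! k" "0 < v ! k" if "k < length v" for k
    using that v by (auto simp: nth_append pwords_iff)
  have "(\<forall>k<i. ?\<eta> ! k = 0) \<longleftrightarrow> j = 0"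
  proof
    assume *: "\<forall>k<i. ?\<eta> ! k = 0"
    show "j = 0"
    proof (rule ccontr)
      assume "j \<noteq> 0"
      then have "a + 0 < i" using i by simp
      then have "?\<eta> ! (a + 0) = 0" using * by blast
      then show False using nth[of 0] i(2) by force
    qed
  qed (use i in \<open>auto simp: nth_append\<close>)
  moreover have "(\<forall>k. i < k \<and> k < length ?\<eta> \<longrightarrow> ?\<eta> ! k = 0) \<longleftrightarrow> Suc j = length v"
  proof
    assume *: "\<forall>k. i < k \<and> k < length ?\<eta> \<longrightarrow> ?\<eta> ! k = 0"
    show "Suc j = length v"
    proof (rule ccontr)
      assume "Suc j \<noteq> length v"
      then have "Suc j < length v" using i by simp
      moreover from this have "?\<eta> ! (a + Suc j) = 0" using * i by simp
      ultimately show False using nth[of "Suc j"] by simp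
    qed
  qed (use i in \<open>auto simp: nth_append\<close>)
  moreover have "i < length ?\<eta>" using i by simp
  moreover have "(\<exists>j'. i = a + j' \<and> word_reducible v j') \<longleftrightarrow> word_reducible v j" using i(1) by auto
  ultimately show ?thesis
    unfolding emb_reducible_def using nth[OF i(2)] i by (auto simp: word_reducible_def)
next
  case False
  then have "(replicate a 0 @ v @ replicate b 0) ! i = 0" if "i < a + length v + b"
    using that by (auto simp: nth_append)
  then show ?thesis using False by (auto simp: emb_reducible_def word_reducible_def)
qed

text \<open>Reducing a first letter 1 moves the start of the word to the right; every other
  reduction keeps it, which the last conjunct records for comparing labels with positions.\<close>

lemma emb_reduce_pad:
  assumes v: "v \<in> pwords" and j: "word_reducible v j"
  shows "\<exists>a' b'. emb_reduce (replicate a 0 @ v @ replicate b 0) (a + j) =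
    replicate a' 0 @ word_reduce v j @ replicate b' 0 \<and> (0 < j \<longrightarrow> a' = a)"
proof -
  have jl: "j < length v" using j by (simp add: word_reducible_def)
  have *: "emb_reduce (replicate a 0 @ v @ replicate b 0) (a + j) =
      replicate a 0 @ v[j := v ! j - 1] @ replicate b 0"
    using jl by (simp add: emb_reduce_def list_update_append nth_append)
  consider "v ! j > 1" | "v ! j = 1" "j = 0" | "v ! j = 1" "j \<noteq> 0" "Suc j = length v"
    using j by (auto simp: word_reducible_def)
  then show ?thesis
  proof cases
    case 1
    then show ?thesis unfolding * by (auto simp: word_reduce_def)
  next
    case 2
    then obtain v' where v': "v = 1 # v'" using jl by (cases v) auto
    have "replicate a 0 @ v[j := v ! j - 1] @ replicate b 0 =
        replicate (Suc a) 0 @ word_reduce v j @ replicate b 0"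
      using 2 v' by (simp add: word_reduce_def replicate_app_Cons_same)
    then show ?thesis unfolding * using 2 by blast
  next
    case 3
    then obtain v' where v': "v = v' @ [1]" "length v' = j"
      by (cases v rule: rev_cases) (auto simp: nth_append)
    have "replicate a 0 @ v[j := v ! j - 1] @ replicate b 0 =
        replicate a 0 @ word_reduce v j @ replicate (Suc b) 0"
      using v' 3(1) by (simp add: word_reduce_def list_update_append)
    then show ?thesis unfolding * by blast
  qed
qed

lemma word_reduce_in_pwords:
  assumes "v \<in> pwords" "word_reducible v j"
  shows "word_reduce v j \<in> pwords"
  using assms
  by (auto simp: word_reduce_def word_reducible_def pwords_def nth_list_update
      dest: in_set_takeD in_set_dropD set_update_subset_insert[THEN subsetD])

lemma sum_list_word_reduce:
  assumes "v \<in> pwords" "word_reducible v j"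
  shows "Suc (sum_list (word_reduce v j)) = sum_list v"
proof -
  have j: "j < length v" "0 < v ! j" using assms by (auto simp: word_reducible_def pwords_iff)
  have v: "v = take j v @ v ! j # drop (Suc j) v" using j by (simp add: id_take_nth_drop)
  have "sum_list v = sum_list (take j v) + v ! j + sum_list (drop (Suc j) v)"
    by (subst v) simp
  moreover have "sum_list (word_reduce v j) + 1 = sum_list (take j v) + v ! j + sum_list (drop (Suc j) v)"
    using j by (auto simp: word_reduce_def upd_conv_take_nth_drop)
  ultimately show ?thesis by simp
qed

lemma word_reduce_gf_le:
  assumes "word_reducible v j"
  shows "word_reduce v j \<le>\<^sub>g\<^sub>f v"
proof -
  have jl: "j < length v" using assms by (simp add: word_reducible_def)
  consider "v ! j > 1" | "v ! j = 1" "j = 0" | "v ! j = 1" "j \<noteq> 0" "Suc j = length v"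
    using assms by (auto simp: word_reducible_def)
  then show ?thesis
  proof cases
    case 1
    then show ?thesis
      unfolding gf_le_def by (intro exI[of _ 0]) (simp add: word_reduce_def, metis diff_le_self nth_list_update_eq nth_list_update_neq order_refl)
  next
    case 2
    then show ?thesis
      unfolding gf_le_def using jl by (intro exI[of _ 1]) (auto simp: word_reduce_def)
  next
    case 3
    then show ?thesis
      unfolding gf_le_def by (intro exI[of _ 0]) (auto simp: word_reduce_def)
  qed
qed

lemma Cons_eq_snoc_ones: "(1::nat) # y = y @ [1] \<Longrightarrow> flat y"
  unfolding flat_def by (induction y) auto

text \<open>Equal lengths mean that both letters are lowered or both deleted. In the first case the
  results differ at \<open>i\<close>. In the second, \<open>i\<close> and \<open>j\<close> are the
  ends of \<open>v = 1 # y @ [1]\<close>, and \<open>1 # y = y @ [1]\<close> makes \<open>v\<close>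
  flat, where the last letter is not reducible.\<close>

lemma word_reduce_eq_imp_not_less:
  assumes "word_reducible v i" "word_reducible v j" "word_reduce v i = word_reduce v j"
  shows "\<not> i < j"
proof
  assume ij: "i < j"
  have jl: "j < length v" using assms(2) by (simp add: word_reducible_def)
  have len: "(v ! i = 1) = (v ! j = 1)"
    using arg_cong[OF assms(3), of length] ij jl by (auto simp: length_word_reduce split: if_splits)
  show False
  proof (cases "v ! i = 1")
    case False
    then have "v ! i > 1" using assms(1) ij jl by (auto simp: word_reducible_def)
    moreover have "word_reduce v i ! i = v ! i - 1" using False ij jl by (simp add: word_reduce_def)
    ultimately show False using nth_word_reduce[OF ij jl] assms(3) by simp
  next
    case True
    then have "i = 0" using assms(1) ij jl by (auto simp: word_reducible_def)
    moreover have j: "Suc j = length v" "\<not> flat v" "v ! j = 1"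
      using assms(2) True len ij by (auto simp: word_reducible_def)
    moreover obtain y where y: "v = 1 # y @ [1]" "length y = j - 1"
    proof -
      obtain v' where "v = 1 # v'" using True \<open>i = 0\<close> jl by (cases v) auto
      moreover from this have "v' \<noteq> []" using ij jl by auto
      ultimately have "v = 1 # butlast v' @ [1]" "length (butlast v') = j - 1"
        using j append_butlast_last_id[OF \<open>v' \<noteq> []\<close>] by (auto simp: last_conv_nth nth_Cons')
      then show thesis by (rule that)
    qed
    ultimately have "y @ [1] = 1 # y"
      using assms(3) ij by (cases j) (auto simp: word_reduce_def nth_append)
    then have "flat y" by (metis Cons_eq_snoc_ones)
    then have "flat v" using y(1) by (auto simp: flat_def)
    then show False using j by simp
  qed
qed

lemma word_reduce_inj:
  "word_reducible v i \<Longrightarrow> word_reducible v j \<Longrightarrow> word_reduce v i = word_reduce v j \<Longrightarrow> i = j"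
  using word_reduce_eq_imp_not_less[of v i j] word_reduce_eq_imp_not_less[of v j i] by simp

text \<open>Some letter can always be spared: the first one if \<open>v\<close> is flat or the
  occurrence of \<open>x\<close> starts at \<open>k > 0\<close>, the last one if
  \<open>k = 0\<close> and \<open>x\<close> is shorter, and otherwise a letter where
  \<open>v\<close> exceeds \<open>x\<close>. Hence every word covered by \<open>v\<close> is a
  reduction of \<open>v\<close>.\<close>

lemma gf_less_word_reduce:
  assumes "v \<in> pwords" "x \<in> pwords" "x \<le>\<^sub>g\<^sub>f v" "x \<noteq> v"
  shows "\<exists>j. word_reducible v j \<and> x \<le>\<^sub>g\<^sub>f word_reduce v j"
proof -
  obtain k where k: "occurs_at x v k" using assms(3) by (auto simp: gf_le_iff_occurs)
  have v0: "v \<noteq> []" using k assms(4) by (auto simp: occurs_at_def)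
  have pos: "0 < v ! i" if "i < length v" for i using that assms(1) by (simp add: pwords_iff)
  have red0: "word_reducible v 0" using v0 pos[of 0] by (auto simp: word_reducible_def)
  consider "flat v" | "\<not> flat v" "0 < k" | "\<not> flat v" "k = 0" "length x < length v"
    | "k = 0" "length x = length v"
    using k by (force simp: occurs_at_def)
  then show ?thesis
  proof cases
    case 1
    then have fx: "flat x" using gf_le_flat assms by blast
    have "length x \<noteq> length v"
      using 1 fx assms(4) by (metis flat_iff nth_equalityI)
    then have "length x < length v" using k by (simp add: occurs_at_def)
    moreover have "word_reduce v 0 = tl v" using 1 v0 by (cases v) (auto simp: word_reduce_def flat_def)
    ultimately have "x \<le>\<^sub>g\<^sub>f word_reduce v 0"
      using 1 fx unfolding gf_le_def by (intro exI[of _ 0]) (auto simp: flat_iff nth_tl)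
    then show ?thesis using red0 by blast
  next
    case 2
    have "x \<le>\<^sub>g\<^sub>f word_reduce v 0"
    proof (cases "v ! 0 = 1")
      case True
      then have "occurs_at x (word_reduce v 0) (k - 1)"
        using k 2(2) v0 by (auto simp: occurs_at_def word_reduce_def nth_tl drop_Suc)
      then show ?thesis by (auto simp: gf_le_iff_occurs)
    next
      case False
      then have "occurs_at x (word_reduce v 0) k"
        using k 2(2) by (auto simp: occurs_at_def word_reduce_def)
      then show ?thesis by (auto simp: gf_le_iff_occurs)
    qed
    then show ?thesis using red0 by blast
  next
    case 3
    let ?j = "length v - 1"
    have j: "?j < length v" using v0 by simp
    have "word_reducible v ?j" using 3 pos[OF j] by (auto simp: word_reducible_def)
    moreover have "occurs_at x (word_reduce v ?j) 0"
      unfolding occurs_at_def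
    proof (intro conjI allI impI)
      show "0 + length x \<le> length (word_reduce v ?j)" using 3 j by (auto simp: length_word_reduce)
      fix i assume "i < length x"
      then have "i < ?j" "x ! i \<le> v ! i" using 3 k by (auto simp: occurs_at_def)
      then show "x ! i \<le> word_reduce v ?j ! (0 + i)" using j by (simp add: nth_word_reduce)
    qed
    ultimately show ?thesis unfolding gf_le_iff_occurs by blast
  next
    case 4
    then obtain j where j: "j < length v" "x ! j \<noteq> v ! j" using assms(4) nth_equalityI[of x v] by auto
    have xv: "x ! i \<le> v ! i" if "i < length v" for i
      using k 4 that by (auto simp: occurs_at_def)
    have "0 < x ! j" using assms(2) 4 j by (simp add: pwords_iff)
    then have less: "x ! j < v ! j" "1 < v ! j" using j xv[OF j(1)] by linarith+
    then have "occurs_at x (word_reduce v j) 0"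
      using 4 xv j(1) by (auto simp: occurs_at_def word_reduce_def nth_list_update less_eq_Suc_le)
    moreover have "word_reducible v j" using j less by (simp add: word_reducible_def)
    ultimately show ?thesis unfolding gf_le_iff_occurs by blast
  qed
qed

text \<open>Reducing at \<open>i\<close> leaves earlier letters alone and can make one reducible
  only by turning an inner 1 into the last letter. Then \<open>v\<close> ends in two ones and both
  get removed, which is precisely what a strong descent forbids.\<close>

lemma word_reducible_swap:
  assumes "word_reducible v i" "j < i" "word_reducible (word_reduce v i) j"
  shows "word_reducible v j \<or> i = Suc j \<and> v = word_reduce (word_reduce v i) j @ [1, 1]"
proof (rule disjCI)
  assume nr: "\<not> (i = Suc j \<and> v = word_reduce (word_reduce v i) j @ [1, 1])"
  let ?v = "word_reduce v i"
  have il: "i < length v" using assms(1) by (simp add: word_reducible_def)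
  have vj: "?v ! j = v ! j" using nth_word_reduce[OF assms(2) il] .
  have "False" if "v ! j = 1" "j \<noteq> 0"
  proof -
    have last: "Suc j = length ?v" using assms(3) vj that by (auto simp: word_reducible_def)
    then have vi: "v ! i = 1" using assms(2) il by (auto simp: length_word_reduce split: if_splits)
    then have il': "Suc i = length v" using assms(1,2) by (auto simp: word_reducible_def)
    then have ij: "i = Suc j" using last vi il by (simp add: length_word_reduce)
    have v1: "?v = take i v" using vi il' by (simp add: word_reduce_def)
    have v: "v = take i v @ [1]" using vi il' il by (metis take_Suc_conv_app_nth take_all order_refl)
    have "word_reduce ?v j = take j v"
      using that(1) ij il' vj unfolding v1 by (simp add: word_reduce_def)
    moreover have "take i v = take j v @ [1]"
      using that(1) ij il by (simp add: take_Suc_conv_app_nth)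
    ultimately have "v = word_reduce ?v j @ [1, 1]" using v by simp
    then show False using nr ij by blast
  qed
  then show "word_reducible v j" using assms vj il by (auto simp: word_reducible_def)
qed

lemma word_reducible_mono:
  assumes "word_reducible v i" "word_reducible v j" "j < i"
  shows "word_reducible (word_reduce v i) j"
proof -
  have il: "i < length v" using assms(1) by (simp add: word_reducible_def)
  have "word_reduce v i ! j = v ! j" using nth_word_reduce[OF assms(3) il] .
  moreover have "j < length (word_reduce v i)" using assms(3) il by (auto simp: length_word_reduce)
  ultimately show ?thesis using assms(2,3) il by (auto simp: word_reducible_def)
qed

text \<open>Removing two ones at positions reducible from the start means deleting both ends of
  \<open>v = 1 # y @ [1]\<close>. The equation would give \<open>1 # y = y @ [1]\<close>, so
  \<open>v\<close> would be flat and its last letter not reducible.\<close>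

lemma word_reduce_twice_neq:
  assumes "word_reducible v i" "word_reducible v j" "j < i"
  shows "v \<noteq> word_reduce (word_reduce v i) j @ [1, 1]"
proof
  assume eq: "v = word_reduce (word_reduce v i) j @ [1, 1]"
  have il: "i < length v" using assms(1) by (simp add: word_reducible_def)
  have vj: "word_reduce v i ! j = v ! j" using nth_word_reduce[OF assms(3) il] .
  have jl: "j < length (word_reduce v i)" using assms(3) il by (auto simp: length_word_reduce)
  have "length v = length (word_reduce (word_reduce v i) j) + 2"
    using arg_cong[OF eq, of length] by simp
  then have ones: "v ! i = 1" "v ! j = 1"
    using length_word_reduce[OF il] length_word_reduce[OF jl] vj by (presburger, presburger)
  have j: "j = 0" using assms(2,3) il ones by (auto simp: word_reducible_def)
  have i: "Suc i = length v" "\<not> flat v" using assms(1,3) ones by (auto simp: word_reducible_def)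
  obtain y where y: "v = 1 # y @ [1]" "length y = i - 1"
  proof -
    obtain v' where "v = 1 # v'" using ones j il by (cases v) auto
    moreover from this have "v' \<noteq> []" using assms(3) il by auto
    ultimately have "v = 1 # butlast v' @ [1]" "length (butlast v') = i - 1"
      using i ones append_butlast_last_id[OF \<open>v' \<noteq> []\<close>] assms(3)
      by (auto simp: last_conv_nth nth_Cons')
    then show thesis by (rule that)
  qed
  have "word_reduce v i = 1 # y"
    using y ones assms(3) by (cases i) (auto simp: word_reduce_def)
  then have "word_reduce (word_reduce v i) j = y" using j by (simp add: word_reduce_def)
  then have "1 # y = y @ [1]" using eq y(1) by simp
  then have "flat y" by (rule Cons_eq_snoc_ones)
  then have "flat v" using y(1) by (auto simp: flat_def)
  then show False using i by simp
qed

subsection \<open>Reductions of embeddings\<close>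

abbreviation red :: "nat list \<Rightarrow> nat \<Rightarrow> bool" where
  "red \<eta> i \<equiv> emb_reducible \<eta> (strip \<eta>) i"

definition start :: "nat list \<Rightarrow> nat" where
  "start \<eta> = length (takeWhile (\<lambda>a. a = 0) \<eta>)"

lemma start_pad:
  assumes "v \<in> pwords" "v \<noteq> []"
  shows "start (replicate a 0 @ v @ replicate b 0) = a"
proof -
  have "hd v \<noteq> 0" using assms by (cases v) (auto simp: pwords_def)
  then show ?thesis using assms(2) by (cases v) (auto simp: start_def takeWhile_append)
qed

lemma nth_less_start:
  assumes "i < start \<eta>"
  shows "\<eta> ! i = 0"
proof -
  have "takeWhile (\<lambda>a. a = 0) \<eta> ! i \<in> set (takeWhile (\<lambda>a. a = 0) \<eta>)"
    using assms by (simp add: start_def)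
  then show ?thesis using assms set_takeWhileD by (fastforce simp: start_def takeWhile_nth)
qed

lemma contiguous_startE:
  assumes "contiguous \<eta>" "strip \<eta> \<noteq> []"
  obtains b where "\<eta> = replicate (start \<eta>) 0 @ strip \<eta> @ replicate b 0"
proof -
  obtain a b where ab: "\<eta> = replicate a 0 @ strip \<eta> @ replicate b 0"
    using assms(1) by (auto simp: contiguous_def)
  then have "start \<eta> = a" using start_pad[OF strip_in_pwords assms(2), of a b] by simp
  then show thesis using ab that by simp
qed

lemma red_iff:
  assumes "contiguous \<eta>"
  shows "red \<eta> i \<longleftrightarrow> (\<exists>j. i = start \<eta> + j \<and> word_reducible (strip \<eta>) j)"
proof (cases "strip \<eta> = []")
  case True
  then have "\<forall>a\<in>set \<eta>. a = 0" by (auto simp: strip_def filter_empty_conv)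
  then have "\<eta> ! i = 0" if "i < length \<eta>" using that by simp
  then show ?thesis using True by (auto simp: emb_reducible_def word_reducible_def)
next
  case False
  obtain b where "\<eta> = replicate (start \<eta>) 0 @ strip \<eta> @ replicate b 0"
    using contiguous_startE[OF assms False] .
  then show ?thesis using emb_reducible_pad[of "strip \<eta>" "start \<eta>" b i] by simp
qed

lemma emb_reduce_start:
  assumes "contiguous \<eta>" "word_reducible (strip \<eta>) j"
  shows "strip (emb_reduce \<eta> (start \<eta> + j)) = word_reduce (strip \<eta>) j"
    and "contiguous (emb_reduce \<eta> (start \<eta> + j))"
    and "0 < j \<Longrightarrow> start (emb_reduce \<eta> (start \<eta> + j)) = start \<eta>"
proof -
  let ?v = "strip \<eta>"
  have ne: "?v \<noteq> []" using assms(2) by (auto simp: word_reducible_def)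
  have p: "word_reduce ?v j \<in> pwords" using word_reduce_in_pwords assms(2) by simp
  obtain b where "\<eta> = replicate (start \<eta>) 0 @ ?v @ replicate b 0"
    using contiguous_startE[OF assms(1) ne] .
  then obtain a' b' where *: "emb_reduce \<eta> (start \<eta> + j) = replicate a' 0 @ word_reduce ?v j @ replicate b' 0"
    "0 < j \<longrightarrow> a' = start \<eta>"
    using emb_reduce_pad[OF strip_in_pwords assms(2), of "start \<eta>" b] by auto
  show "strip (emb_reduce \<eta> (start \<eta> + j)) = word_reduce ?v j" "contiguous (emb_reduce \<eta> (start \<eta> + j))"
    unfolding * using strip_pad contiguous_pad p by auto
  assume "0 < j"
  then have "word_reduce ?v j \<noteq> []"
    using assms(2) length_word_reduce[of j ?v] by (auto simp: word_reducible_def split: if_splits)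
  then show "start (emb_reduce \<eta> (start \<eta> + j)) = start \<eta>"
    unfolding * using start_pad[OF p] *(2) \<open>0 < j\<close> by simp
qed

lemma contiguous_reduce:
  assumes "contiguous \<eta>" "red \<eta> i"
  shows "contiguous (emb_reduce \<eta> i)"
proof -
  obtain j where "i = start \<eta> + j" "word_reducible (strip \<eta>) j"
    using red_iff[OF assms(1)] assms(2) by blast
  then show ?thesis using emb_reduce_start(2)[OF assms(1)] by simp
qed

lemma strip_reduceE:
  assumes "contiguous \<eta>" "red \<eta> i"
  obtains j where "i = start \<eta> + j" "word_reducible (strip \<eta>) j"
    "strip (emb_reduce \<eta> i) = word_reduce (strip \<eta>) j"
proof -
  obtain j where "i = start \<eta> + j" "word_reducible (strip \<eta>) j"
    using red_iff[OF assms(1)] assms(2) by blast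
  then show thesis using emb_reduce_start(1)[OF assms(1)] that by simp
qed

lemma reduce_inj:
  assumes "contiguous \<eta>" "red \<eta> i" "red \<eta> j" "strip (emb_reduce \<eta> i) = strip (emb_reduce \<eta> j)"
  shows "i = j"
proof -
  obtain i' j' where "i = start \<eta> + i'" "word_reducible (strip \<eta>) i'"
    "strip (emb_reduce \<eta> i) = word_reduce (strip \<eta>) i'"
    "j = start \<eta> + j'" "word_reducible (strip \<eta>) j'"
    "strip (emb_reduce \<eta> j) = word_reduce (strip \<eta>) j'"
    using strip_reduceE[OF assms(1,2)] strip_reduceE[OF assms(1,3)] by metis
  then show ?thesis using assms(4) word_reduce_inj by metis
qed

lemma red_swap:
  assumes "contiguous \<eta>" "red \<eta> i" "j < i" "red (emb_reduce \<eta> i) j"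
  shows "red \<eta> j \<or> i = Suc j \<and> strip \<eta> = strip (emb_reduce (emb_reduce \<eta> i) j) @ [1, 1]"
proof -
  let ?v = "strip \<eta>" and ?\<eta> = "emb_reduce \<eta> i"
  obtain i' where i': "i = start \<eta> + i'" "word_reducible ?v i'" "strip ?\<eta> = word_reduce ?v i'"
    using strip_reduceE[OF assms(1,2)] .
  \<comment> \<open>Were the first letter of the word reduced, only padding would precede
    \<open>i\<close> and \<open>j\<close> could not be reducible. So \<open>start\<close> is
    unchanged, and labels and positions differ by the same offset before and after.\<close>
  have "0 < i'"
  proof (rule ccontr)
    assume "\<not> 0 < i'"
    then have "\<eta> ! j = 0" using assms(3) i' nth_less_start by simp
    then have "?\<eta> ! j = 0" using assms(3) by (simp add: emb_reduce_def)
    then show False using assms(4) by (simp add: emb_reducible_def)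
  qed
  then have st: "start ?\<eta> = start \<eta>" using emb_reduce_start(3) assms(1) i' by simp
  obtain j' where j': "j = start ?\<eta> + j'" "word_reducible (strip ?\<eta>) j'"
    "strip (emb_reduce ?\<eta> j) = word_reduce (strip ?\<eta>) j'"
    using strip_reduceE[OF contiguous_reduce[OF assms(1,2)] assms(4)] .
  have "word_reducible ?v j' \<or> i' = Suc j' \<and> ?v = word_reduce (word_reduce ?v i') j' @ [1, 1]"
    using word_reducible_swap[OF i'(2)] j' i' st assms(3) by simp
  then show ?thesis using red_iff[OF assms(1)] i' j' st by auto
qed

lemma red_pair:
  assumes "contiguous \<eta>" "red \<eta> i" "red \<eta> j" "j < i"
  shows "red (emb_reduce \<eta> i) j"
    and "strip \<eta> \<noteq> strip (emb_reduce (emb_reduce \<eta> i) j) @ [1, 1]"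
proof -
  let ?v = "strip \<eta>" and ?\<eta> = "emb_reduce \<eta> i"
  obtain i' where i': "i = start \<eta> + i'" "word_reducible ?v i'" "strip ?\<eta> = word_reduce ?v i'"
    using strip_reduceE[OF assms(1,2)] .
  obtain j' where j': "j = start \<eta> + j'" "word_reducible ?v j'"
    using strip_reduceE[OF assms(1,3)] by metis
  have lt: "j' < i'" using assms(4) i' j' by simp
  then have st: "start ?\<eta> = start \<eta>" using emb_reduce_start(3) assms(1) i' by simp
  have r: "word_reducible (strip ?\<eta>) j'" using word_reducible_mono[OF i'(2) j'(2) lt] i' by simp
  note c = contiguous_reduce[OF assms(1,2)]
  show "red ?\<eta> j" using red_iff[OF c] r j' st by auto
  have "strip (emb_reduce ?\<eta> j) = word_reduce (word_reduce ?v i') j'"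
    using emb_reduce_start(1)[OF c r] st j' i' by simp
  then show "?v \<noteq> strip (emb_reduce ?\<eta> j) @ [1, 1]"
    using word_reduce_twice_neq[OF i'(2) j'(2) lt] by simp
qed

subsection \<open>Chain ids\<close>

text \<open>The embeddings that \<open>is_chain_id\<close> quantifies over are determined by the
  labels; recursion on the labels produces them.\<close>

fun valid_id :: "nat list \<Rightarrow> nat list \<Rightarrow> bool" where
  "valid_id \<eta> [] \<longleftrightarrow> True"
| "valid_id \<eta> (i # l) \<longleftrightarrow> red \<eta> i \<and> valid_id (emb_reduce \<eta> i) l"

fun chain_words :: "nat list \<Rightarrow> nat list \<Rightarrow> nat list list" where
  "chain_words \<eta> [] = [strip \<eta>]"
| "chain_words \<eta> (i # l) = strip \<eta> # chain_words (emb_reduce \<eta> i) l"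

lemma length_chain_words [simp]: "length (chain_words \<eta> l) = Suc (length l)"
  by (induction l arbitrary: \<eta>) auto

lemma chain_words_neq_Nil [simp]: "chain_words \<eta> l \<noteq> []"
  by (cases l) auto

lemmas Nil_neq_chain_words [simp] = chain_words_neq_Nil[symmetric]

lemma hd_chain_words [simp]: "hd (chain_words \<eta> l) = strip \<eta>"
  by (cases l) auto

lemma nth_chain_words:
  "i \<le> length l \<Longrightarrow> chain_words \<eta> l ! i = strip (foldl emb_reduce \<eta> (take i l))"
proof (induction l arbitrary: \<eta> i)
  case (Cons a l)
  then show ?case by (cases i) auto
qed simp

lemma last_chain_words: "last (chain_words \<eta> l) = strip (foldl emb_reduce \<eta> l)"
  by (induction l arbitrary: \<eta>) auto

lemma set_chain_words: "set (chain_words \<eta> l) \<subseteq> pwords"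
  by (induction l arbitrary: \<eta>) auto

lemma valid_id_append:
  "valid_id \<eta> (xs @ ys) \<longleftrightarrow> valid_id \<eta> xs \<and> valid_id (foldl emb_reduce \<eta> xs) ys"
  by (induction xs arbitrary: \<eta>) auto

lemma chain_words_append:
  "chain_words \<eta> (xs @ i # ys) =
    chain_words \<eta> xs @ chain_words (emb_reduce (foldl emb_reduce \<eta> xs) i) ys"
  by (induction xs arbitrary: \<eta>) auto

lemma valid_id_contiguous:
  "contiguous \<eta> \<Longrightarrow> valid_id \<eta> l \<Longrightarrow> contiguous (foldl emb_reduce \<eta> l)"
  by (induction l arbitrary: \<eta>) (auto intro: contiguous_reduce)

lemma valid_id_sum_list:
  "valid_id \<eta> l \<Longrightarrow> sum_list (foldl emb_reduce \<eta> l) + length l = sum_list \<eta>"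
proof (induction l arbitrary: \<eta>)
  case (Cons i l)
  then have i: "i < length \<eta>" "0 < \<eta> ! i" by (auto simp: emb_reducible_def)
  have "sum_list (emb_reduce \<eta> i) + 1 = sum_list \<eta>"
    using i elem_le_sum_list[OF i(1)] by (simp add: emb_reduce_def sum_list_update)
  then show ?case using Cons by simp
qed simp

lemma foldl_emb_reduce_le:
  "length (foldl emb_reduce \<eta> l) = length \<eta> \<and> (\<forall>i<length \<eta>. foldl emb_reduce \<eta> l ! i \<le> \<eta> ! i)"
proof (induction l arbitrary: \<eta>)
  case (Cons j l)
  have "emb_reduce \<eta> j ! i \<le> \<eta> ! i" if "i < length \<eta>" for i
    using that by (cases "i = j") (auto simp: emb_reduce_def)
  moreover have "length (emb_reduce \<eta> j) = length \<eta>" by (simp add: emb_reduce_def)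
  ultimately show ?case using Cons[of "emb_reduce \<eta> j"] by (auto intro: order_trans)
qed simp

lemma valid_id_nth:
  "valid_id \<eta> l \<Longrightarrow> i < length l \<Longrightarrow> red (foldl emb_reduce \<eta> (take i l)) (l ! i)"
proof (induction l arbitrary: \<eta> i)
  case (Cons a l)
  then show ?case by (cases i) auto
qed simp

lemma is_chain_id_chain_words:
  assumes w: "w \<in> pwords" and l: "valid_id w l"
  shows "is_chain_id (chain_words w l) l"
proof -
  let ?C = "chain_words w l"
  define \<eta> where "\<eta> = (\<lambda>i. foldl emb_reduce w (take i l))"
  have C: "?C ! i = strip (\<eta> i)" if "i \<le> length l" for i
    using that by (simp add: \<eta>_def nth_chain_words)
  have C0: "?C ! 0 = w" using C[of 0] w by (simp add: \<eta>_def strip_pwords)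
  have "word_embedding (\<eta> i) (?C ! i) (?C ! 0)" if "i \<le> length l" for i
  proof -
    have "valid_id w (take i l)" using l valid_id_append[of w "take i l" "drop i l"] by simp
    then have "contiguous (\<eta> i)"
      unfolding \<eta>_def using valid_id_contiguous contiguous_pwords[OF w] by blast
    then show ?thesis
      unfolding word_embedding_def C[OF that] C0 contiguous_def
      using foldl_emb_reduce_le[of w "take i l"] by (simp add: \<eta>_def)
  qed
  moreover have "emb_reducible (\<eta> i) (?C ! i) (l ! i) \<and> \<eta> (Suc i) = emb_reduce (\<eta> i) (l ! i)"
    if "i < length l" for i
    using valid_id_nth[OF l that] that C[of i] by (simp add: \<eta>_def take_Suc_conv_app_nth)
  moreover have "\<eta> 0 = ?C ! 0" using C0 by (simp add: \<eta>_def)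
  ultimately show ?thesis
    unfolding is_chain_id_def using length_chain_words by blast
qed

lemma is_chain_idD:
  assumes C: "is_chain_id C l" and w: "set C \<subseteq> pwords"
  shows "valid_id (C ! 0) l" "C = chain_words (C ! 0) l"
proof -
  obtain \<eta> where \<eta>: "\<eta> 0 = C ! 0" "length C = Suc (length l)"
    "\<And>i. i \<le> length l \<Longrightarrow> word_embedding (\<eta> i) (C ! i) (C ! 0)"
    "\<And>i. i < length l \<Longrightarrow> emb_reducible (\<eta> i) (C ! i) (l ! i) \<and> \<eta> (Suc i) = emb_reduce (\<eta> i) (l ! i)"
    using C by (auto simp: is_chain_id_def)
  have Cn: "C ! i = strip (\<eta> i)" if "i \<le> length l" for i
  proof -
    have "C ! i \<in> pwords" using w \<eta>(2) that by (auto simp: subset_iff)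
    then show ?thesis using \<eta>(3)[OF that] strip_pad by (auto simp: word_embedding_def)
  qed
  \<comment> \<open>Stated for arbitrary \<open>C\<close>, \<open>l\<close> and family of
    embeddings, so that the induction can pass to the tail of the chain with the shifted
    family.\<close>
  have gen: "valid_id (\<eta> 0) l \<and> C = chain_words (\<eta> 0) l"
    if "length C = Suc (length l)" "\<And>i. i \<le> length l \<Longrightarrow> C ! i = strip (\<eta> i)"
      "\<And>i. i < length l \<Longrightarrow> red (\<eta> i) (l ! i) \<and> \<eta> (Suc i) = emb_reduce (\<eta> i) (l ! i)"
    for C l and \<eta> :: "nat \<Rightarrow> nat list"
    using that
  proof (induction l arbitrary: C \<eta>)
    case Nil
    then show ?case by (cases C) auto
  next
    case (Cons j l)
    obtain c C' where C': "C = c # C'" using Cons.prems(1) by (cases C) auto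
    have "valid_id (\<eta> (Suc 0)) l \<and> C' = chain_words (\<eta> (Suc 0)) l"
    proof (rule Cons.IH[of C' "\<lambda>i. \<eta> (Suc i)"])
      show "length C' = Suc (length l)" using Cons.prems(1) C' by simp
      show "C' ! i = strip (\<eta> (Suc i))" if "i \<le> length l" for i
        using Cons.prems(2)[of "Suc i"] C' that by simp
      show "red (\<eta> (Suc i)) (l ! i) \<and> \<eta> (Suc (Suc i)) = emb_reduce (\<eta> (Suc i)) (l ! i)"
        if "i < length l" for i
        using Cons.prems(3)[of "Suc i"] that by simp
    qed
    then show ?case using Cons.prems(2)[of 0] Cons.prems(3)[of 0] C' by simp
  qed
  have "valid_id (\<eta> 0) l \<and> C = chain_words (\<eta> 0) l"
  proof (rule gen[OF \<eta>(2) Cn])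
    show "red (\<eta> i) (l ! i) \<and> \<eta> (Suc i) = emb_reduce (\<eta> i) (l ! i)" if "i < length l" for i
      using \<eta>(4)[OF that] Cn[of i] that by simp
  qed
  then show "valid_id (C ! 0) l" "C = chain_words (C ! 0) l" using \<eta>(1) by simp_all
qed

text \<open>Different labels lead to different words by \<open>reduce_inj\<close>, so a chain
  determines its labels; thus the \<open>THE\<close> in \<open>chain_id\<close> is well
  defined.\<close>

lemma chain_words_inj:
  "contiguous \<eta> \<Longrightarrow> valid_id \<eta> l \<Longrightarrow> valid_id \<eta> l' \<Longrightarrow> chain_words \<eta> l = chain_words \<eta> l' \<Longrightarrow> l = l'"
proof (induction l arbitrary: \<eta> l')
  case Nil
  then show ?case by (cases l') auto
next
  case (Cons i l)
  then obtain j k where l': "l' = j # k" by (cases l') auto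
  have "chain_words (emb_reduce \<eta> i) l = chain_words (emb_reduce \<eta> j) k" using Cons.prems l' by simp
  moreover from this have "strip (emb_reduce \<eta> i) = strip (emb_reduce \<eta> j)"
    by (metis hd_chain_words)
  then have "i = j" using Cons.prems l' reduce_inj[of \<eta> i j] by simp
  ultimately show ?case using Cons.IH[of "emb_reduce \<eta> i" k] Cons.prems l' contiguous_reduce by auto
qed

lemma chain_id_chain_words:
  assumes "w \<in> pwords" "valid_id w l"
  shows "chain_id (chain_words w l) = l"
  unfolding chain_id_def
proof (rule the_equality)
  show "is_chain_id (chain_words w l) l" using is_chain_id_chain_words assms by blast
  fix l' assume "is_chain_id (chain_words w l) l'"
  moreover have "chain_words w l ! 0 = w"
    using assms(1) by (simp add: nth_chain_words strip_pwords)
  ultimately have "valid_id w l'" "chain_words w l = chain_words w l'"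
    using is_chain_idD set_chain_words by metis+
  then show "l' = l" using chain_words_inj contiguous_pwords assms by metis
qed

subsection \<open>Maximal chains\<close>

lemma gf_covered_byI:
  assumes "x \<in> pwords" "y \<in> pwords" "x \<le>\<^sub>g\<^sub>f y" "Suc (sum_list x) = sum_list y"
  shows "gf_covered_by x y"
proof -
  have "False" if "z \<in> pwords" "x \<le>\<^sub>g\<^sub>f z" "z \<le>\<^sub>g\<^sub>f y" "z \<noteq> x" "z \<noteq> y" for z
    using gf_less_rank[of x z] gf_less_rank[of z y] that assms by (simp add: word_rank_def)
  then show ?thesis using assms unfolding gf_covered_by_def by fastforce
qed

lemma gf_covered_byE:
  assumes "gf_covered_by x v" "x \<in> pwords" "v \<in> pwords"
  obtains j where "word_reducible v j" "x = word_reduce v j"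
proof -
  obtain j where j: "word_reducible v j" "x \<le>\<^sub>g\<^sub>f word_reduce v j"
    using gf_less_word_reduce assms unfolding gf_covered_by_def by blast
  have "word_reduce v j \<noteq> v" using sum_list_word_reduce[OF assms(3) j(1)] by auto
  then have "word_reduce v j = x"
    using assms(1) j word_reduce_in_pwords[OF assms(3) j(1)] word_reduce_gf_le[OF j(1)]
    unfolding gf_covered_by_def by blast
  then show thesis using j that by blast
qed

lemma covers_chain_words:
  "contiguous \<eta> \<Longrightarrow> valid_id \<eta> l \<Longrightarrow> successively (\<lambda>y x. gf_covered_by x y) (chain_words \<eta> l)"
proof (induction l arbitrary: \<eta>)
  case (Cons i l)
  then obtain j where j: "word_reducible (strip \<eta>) j" "strip (emb_reduce \<eta> i) = word_reduce (strip \<eta>) j"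
    using strip_reduceE[of \<eta> i] by auto
  have "gf_covered_by (strip (emb_reduce \<eta> i)) (strip \<eta>)"
    unfolding j(2)
    by (rule gf_covered_byI) (simp_all add: j(1) word_reduce_in_pwords word_reduce_gf_le sum_list_word_reduce)
  then show ?case
    using Cons contiguous_reduce by (cases l) (auto simp: successively_Cons)
qed simp

lemma covers_imp_chain_words:
  "successively (\<lambda>y x. gf_covered_by x y) C \<Longrightarrow> C \<noteq> [] \<Longrightarrow> set C \<subseteq> pwords \<Longrightarrow>
    contiguous \<eta> \<Longrightarrow> hd C = strip \<eta> \<Longrightarrow> \<exists>l. valid_id \<eta> l \<and> chain_words \<eta> l = C"
proof (induction C arbitrary: \<eta>)
  case (Cons v C)
  show ?case
  proof (cases "C = []")
    case True
    then show ?thesis using Cons.prems by (intro exI[of _ "[]"]) auto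
  next
    case False
    then have "gf_covered_by (hd C) (strip \<eta>)" "hd C \<in> pwords"
      using Cons.prems by (auto simp: successively_Cons)
    then obtain j where j: "word_reducible (strip \<eta>) j" "hd C = word_reduce (strip \<eta>) j"
      using gf_covered_byE strip_in_pwords by metis
    let ?i = "start \<eta> + j"
    have i: "red \<eta> ?i" "hd C = strip (emb_reduce \<eta> ?i)" "contiguous (emb_reduce \<eta> ?i)"
      using red_iff[OF Cons.prems(4)] emb_reduce_start[OF Cons.prems(4) j(1)] j by auto
    obtain l where "valid_id (emb_reduce \<eta> ?i) l \<and> chain_words (emb_reduce \<eta> ?i) l = C"
      using Cons.IH[OF _ False _ i(3,2)] Cons.prems False by (auto simp: successively_Cons)
    then show ?thesis using i Cons.prems by (intro exI[of _ "?i # l"]) auto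
  qed
qed simp

lemma max_chains_iff:
  assumes "w \<in> pwords"
  shows "C \<in> max_chains u w \<longleftrightarrow> (\<exists>l. valid_id w l \<and> C = chain_words w l \<and> last C = u)"
proof
  assume "C \<in> max_chains u w"
  then have "successively (\<lambda>y x. gf_covered_by x y) C" "C \<noteq> []" "set C \<subseteq> pwords" "hd C = strip w" "last C = u"
    using assms by (auto simp: max_chains_def successively_conv_nth strip_pwords)
  then show "\<exists>l. valid_id w l \<and> C = chain_words w l \<and> last C = u"
    using covers_imp_chain_words contiguous_pwords[OF assms] by metis
next
  assume "\<exists>l. valid_id w l \<and> C = chain_words w l \<and> last C = u"
  then obtain l where l: "valid_id w l" "C = chain_words w l" "last C = u" by blast
  then have "successively (\<lambda>y x. gf_covered_by x y) C"
    using covers_chain_words contiguous_pwords[OF assms] by blast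
  then show "C \<in> max_chains u w"
    using l assms set_chain_words by (auto simp: max_chains_def successively_conv_nth strip_pwords)
qed

subsection \<open>Chains of strong descents\<close>

fun strong_id :: "nat list \<Rightarrow> nat list \<Rightarrow> bool" where
  "strong_id \<eta> (i # j # l) \<longleftrightarrow>
     j < i \<and> strip \<eta> \<noteq> strip (emb_reduce (emb_reduce \<eta> i) j) @ [1, 1] \<and>
     strong_id (emb_reduce \<eta> i) (j # l)"
| "strong_id \<eta> l \<longleftrightarrow> True"

text \<open>Labels \<open>k\<close> and \<open>Suc k\<close> meet at the chain element with index
  \<open>Suc k\<close>, whose neighbours have indices \<open>k\<close> and
  \<open>Suc (Suc k)\<close>.\<close>

lemma strong_id_iff_nth:
  "strong_id \<eta> l \<longleftrightarrow> (\<forall>k. Suc k < length l \<longrightarrow>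
     l ! Suc k < l ! k \<and> chain_words \<eta> l ! k \<noteq> chain_words \<eta> l ! Suc (Suc k) @ [1, 1])"
proof (induction \<eta> l rule: strong_id.induct)
  case (1 \<eta> i j l)
  let ?P = "\<lambda>k. Suc k < length (i # j # l) \<longrightarrow>
     (i # j # l) ! Suc k < (i # j # l) ! k \<and>
     chain_words \<eta> (i # j # l) ! k \<noteq> chain_words \<eta> (i # j # l) ! Suc (Suc k) @ [1, 1]"
  have "(\<forall>k. ?P k) \<longleftrightarrow> ?P 0 \<and> (\<forall>k. ?P (Suc k))" by (metis not0_implies_Suc)
  also have "?P 0 \<longleftrightarrow> j < i \<and> strip \<eta> \<noteq> strip (emb_reduce (emb_reduce \<eta> i) j) @ [1, 1]"
    by (simp add: nth_chain_words)
  also have "(\<forall>k. ?P (Suc k)) \<longleftrightarrow> strong_id (emb_reduce \<eta> i) (j # l)"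
    unfolding 1 by (simp only: length_Cons nth_Cons_Suc chain_words.simps Suc_less_eq)
  finally show ?case by simp
qed auto

text \<open>Going from right to left, positions further left stay reducible, and by
  \<open>red_swap\<close> one can become newly reducible only through the removal of two final ones,
  which strength excludes. So all labels are already reducible in the starting embedding.\<close>

lemma valid_strong_id_iff:
  "contiguous \<eta> \<Longrightarrow> valid_id \<eta> l \<and> strong_id \<eta> l \<longleftrightarrow> sorted_wrt (>) l \<and> (\<forall>i\<in>set l. red \<eta> i)"
proof (induction l arbitrary: \<eta>)
  case (Cons i l)
  show ?case
  proof (cases "red \<eta> i")
    case True
    let ?\<eta> = "emb_reduce \<eta> i"
    have c: "contiguous ?\<eta>" using contiguous_reduce Cons.prems True by blast
    note IH = Cons.IH[OF c]
    show ?thesis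
    proof
      assume l: "valid_id \<eta> (i # l) \<and> strong_id \<eta> (i # l)"
      then have "strong_id ?\<eta> l" by (cases l) auto
      then have s: "sorted_wrt (>) l" "\<forall>j\<in>set l. red ?\<eta> j" using l IH by auto
      have hd: "j < i" "j = hd l \<or> j < hd l" if "j \<in> set l" for j
        using l s(1) that by (cases l; auto)+
      \<comment> \<open>If \<open>j\<close> were new, \<open>red_swap\<close> would make it
        \<open>i - 1\<close>; the labels decrease from \<open>i\<close>, so \<open>j\<close> would
        be the next label, contradicting strength.\<close>
      have "red \<eta> j" if jl: "j \<in> set l" for j
      proof (rule ccontr)
        assume "\<not> red \<eta> j"
        then have j: "i = Suc j" "strip \<eta> = strip (emb_reduce ?\<eta> j) @ [1, 1]"
          using red_swap[OF Cons.prems True hd(1)[OF jl]] s(2) jl by auto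
        obtain j' l' where l': "l = j' # l'" using jl by (cases l) auto
        have "j' < i" using hd(1) l' by simp
        then have "j = j'" using hd(2)[OF jl] j(1) l' by auto
        then show False using l l' j(2) by simp
      qed
      then show "sorted_wrt (>) (i # l) \<and> (\<forall>j\<in>set (i # l). red \<eta> j)"
        using s(1) hd(1) True by auto
    next
      assume l: "sorted_wrt (>) (i # l) \<and> (\<forall>j\<in>set (i # l). red \<eta> j)"
      then have r: "j < i" "red ?\<eta> j" "strip \<eta> \<noteq> strip (emb_reduce ?\<eta> j) @ [1, 1]"
        if "j \<in> set l" for j
        using that red_pair[OF Cons.prems True, of j] by auto
      then have "valid_id ?\<eta> l \<and> strong_id ?\<eta> l" using IH l by auto
      then show "valid_id \<eta> (i # l) \<and> strong_id \<eta> (i # l)"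
        using True r by (cases l) auto
    qed
  qed auto
qed simp

text \<open>Taking \<open>j\<close> before \<open>i\<close> reaches the same word two steps down and
  replaces only one element; as \<open>j < i\<close>, the resulting chain is earlier.\<close>

lemma strong_chain_singleton_skipped:
  assumes w: "w \<in> pwords" and l: "valid_id w l" "strong_id w l" and k: "Suc k < length l"
  defines "C \<equiv> chain_words w l"
  shows "{C ! Suc k} \<in> skipped_intervals (last C) w C"
proof -
  define xs i j ys where "xs = take k l" and "i = l ! k" and "j = l ! Suc k"
    and "ys = drop (Suc (Suc k)) l"
  have ll: "l = xs @ i # j # ys"
    unfolding xs_def i_def j_def ys_def using k
    by (metis Cons_nth_drop_Suc Suc_lessD append_take_drop_id)
  define \<theta> where "\<theta> = foldl emb_reduce w xs"
  let ?\<theta>i = "emb_reduce \<theta> i"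
  let ?\<theta>ij = "emb_reduce ?\<theta>i j" and ?\<theta>j = "emb_reduce \<theta> j"
  have val: "valid_id w xs" "red \<theta> i" "red ?\<theta>i j" "valid_id ?\<theta>ij ys"
    using l(1) unfolding ll valid_id_append \<theta>_def by auto
  have c: "contiguous \<theta>"
    unfolding \<theta>_def using valid_id_contiguous contiguous_pwords w val(1) by blast
  have Ck: "C ! k = strip \<theta>" "C ! Suc k = strip ?\<theta>i" "C ! Suc (Suc k) = strip ?\<theta>ij"
    using k unfolding C_def by (simp_all add: nth_chain_words take_Suc_conv_app_nth \<theta>_def xs_def i_def j_def)
  have st: "j < i" "strip \<theta> \<noteq> strip ?\<theta>ij @ [1, 1]"
    using l(2) k Ck unfolding strong_id_iff_nth C_def i_def j_def by auto
  have rj: "red \<theta> j" using red_swap[OF c val(2) st(1) val(3)] st(2) by blast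
  have cs: "contiguous ?\<theta>i" "contiguous ?\<theta>j" "contiguous ?\<theta>ij"
    using contiguous_reduce c val rj by blast+
  have comm: "?\<theta>ij = emb_reduce ?\<theta>j i"
    using st(1) by (simp add: emb_reduce_def list_update_swap)
  have "strip ?\<theta>ij \<le>\<^sub>g\<^sub>f ?\<theta>ij" using gf_le_strip[OF cs(3)] gf_le_refl strip_in_pwords by blast
  moreover have "?\<theta>ij \<le>\<^sub>g\<^sub>f ?\<theta>j"
    unfolding comm using foldl_emb_reduce_le[of ?\<theta>j "[i]"]
    by (auto simp: gf_le_def intro!: exI[of _ 0])
  ultimately have "strip ?\<theta>ij \<le>\<^sub>g\<^sub>f strip ?\<theta>j"
    using gf_le_trans gf_le_strip[OF cs(2)] strip_in_pwords by blast
  moreover have "Suc (sum_list (strip ?\<theta>ij)) = sum_list (strip ?\<theta>j)"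
    using valid_id_sum_list[of \<theta> "[i, j]"] valid_id_sum_list[of \<theta> "[j]"] val rj
    by (simp add: sum_list_strip)
  ultimately have "gf_covered_by (strip ?\<theta>ij) (strip ?\<theta>j)" by (simp add: gf_covered_byI)
  then have "successively (\<lambda>y x. gf_covered_by x y) (strip ?\<theta>j # chain_words ?\<theta>ij ys)"
    using covers_chain_words[OF cs(3) val(4)] by (simp add: successively_Cons)
  \<comment> \<open>The label \<open>i\<close> may no longer be reducible once \<open>j\<close> has
    made the word flat, as for the word 21. So the remaining words are kept as a chain of covers,
    and fresh labels \<open>ys'\<close> are derived for them.\<close>
  then obtain ys' where ys': "valid_id ?\<theta>j ys'" "chain_words ?\<theta>j ys' = strip ?\<theta>j # chain_words ?\<theta>ij ys"
    using covers_imp_chain_words[OF _ _ _ cs(2)] set_chain_words by fastforce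
  let ?l' = "xs @ j # ys'"
  let ?C' = "chain_words w ?l'"
  have val': "valid_id w ?l'" using val(1) rj ys'(1) by (simp add: valid_id_append \<theta>_def)
  have C: "C = chain_words w xs @ strip ?\<theta>i # chain_words ?\<theta>ij ys"
    unfolding C_def by (subst ll) (simp add: chain_words_append \<theta>_def)
  have C': "?C' = chain_words w xs @ strip ?\<theta>j # chain_words ?\<theta>ij ys"
    by (simp add: chain_words_append ys'(2) flip: \<theta>_def)
  have "?C' \<in> max_chains (last C) w" using max_chains_iff[OF w] val' C C' by auto
  moreover have "earlier_chain ?C' C"
    unfolding earlier_chain_def C_def chain_id_chain_words[OF w val'] chain_id_chain_words[OF w l(1)]
    by (subst ll) (simp add: lexord_append_left_rightI lexord_append_leftI st(1))
  moreover have oi: "open_interval C k (Suc (Suc k)) = {C ! Suc k}"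
    unfolding open_interval_def by (auto simp: less_Suc_eq)
  moreover have "set C - {strip ?\<theta>i} \<subseteq> set ?C'" unfolding C C' by auto
  then have "set C - {C ! Suc k} \<subseteq> set ?C'" by (simp only: Ck(2))
  moreover have "Suc (Suc k) < length C" using k by (simp add: C_def)
  ultimately show ?thesis
    unfolding skipped_intervals_def
    by (intro CollectI exI[of _ k] exI[of _ "Suc (Suc k)"]) auto
qed

text \<open>Distinct singletons are disjoint, so truncation changes nothing and nothing is
  discarded: each round moves one set from the remaining to the chosen ones. The cardinality clause
  shows that \<open>card M\<close> rounds exhaust \<open>M\<close>.\<close>

lemma J_rounds_singletons:
  assumes "finite M" "\<And>S. S \<in> M \<Longrightarrow> \<exists>x. S = {x}"
  shows "fst (J_rounds C M k) \<subseteq> M \<and> snd (J_rounds C M k) = M - fst (J_rounds C M k) \<and>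
    (snd (J_rounds C M k) = {} \<or> card (fst (J_rounds C M k)) = k)"
proof (induction k)
  case (Suc k)
  obtain J R where JR: "J_rounds C M k = (J, R)" by fastforce
  have ih: "J \<subseteq> M" "R = M - J" "R = {} \<or> card J = k" using Suc JR by auto
  show ?case
  proof (cases "R = {}")
    case True
    then show ?thesis using JR ih by simp
  next
    case False
    define K where "K = first_interval C R"
    have K: "K \<in> R"
      unfolding K_def first_interval_def using False arg_min_nat_lemma[of "\<lambda>I. I \<in> R"] by blast
    have disj: "S - \<Union>(insert K J) = S" if "S \<in> R - {K}" for S
    proof -
      have "S \<inter> T = {}" if "T \<in> insert K J" for T
      proof -
        have "S \<noteq> T" "S \<in> M" "T \<in> M" using that \<open>S \<in> R - {K}\<close> K ih by auto
        then show ?thesis using assms(2)[of S] assms(2)[of T] by auto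
      qed
      then show ?thesis by blast
    qed
    have img: "(\<lambda>S. S - \<Union>(insert K J)) ` (R - {K}) = R - {K}"
      using disj by (simp add: image_cong[of _ _ _ id, simplified])
    have single: "\<exists>x. S = {x}" if "S \<in> R - {K}" for S using assms(2) that ih by blast
    have "minimal_nonempty (R - {K}) = R - {K}"
      unfolding minimal_nonempty_def using single by fastforce
    then have "J_rounds C M (Suc k) = (insert K J, R - {K})"
      using JR False img by (simp add: Let_def K_def[symmetric])
    moreover have "card (insert K J) = Suc k"
      using K ih False finite_subset[OF ih(1) assms(1)] by (auto simp: card_insert_if)
    ultimately show ?thesis using ih K by auto
  qed
qed simp

lemma Union_J_rounds_singletons:
  assumes "finite M" "\<And>S. S \<in> M \<Longrightarrow> \<exists>x. S = {x}"
  shows "(\<Union>k. fst (J_rounds C M k)) = M"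
proof
  note J = J_rounds_singletons[OF assms, of C]
  show "(\<Union>k. fst (J_rounds C M k)) \<subseteq> M" using J by blast
  let ?J = "fst (J_rounds C M (card M))"
  have "?J = M"
  proof (cases "snd (J_rounds C M (card M)) = {}")
    case True
    then show ?thesis using J[of "card M"] by blast
  next
    case False
    then show ?thesis using J[of "card M"] card_subset_eq[OF assms(1)] by blast
  qed
  then show "M \<subseteq> (\<Union>k. fst (J_rounds C M k))" by blast
qed

text \<open>Every inner element alone is skipped, and each skipped interval contains such a
  singleton. So the MSIs are exactly these singletons, and \<open>J_rounds\<close> selects all of
  them, covering the inside of the chain.\<close>

lemma critical_strong_chain:
  assumes w: "w \<in> pwords" and l: "valid_id w l" "strong_id w l"
  defines "C \<equiv> chain_words w l"
  shows "critical_chain (last C) w C"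
proof -
  let ?I = "{{C ! Suc k} | k. Suc k < length l}"
  have sk: "?I \<subseteq> skipped_intervals (last C) w C"
    using strong_chain_singleton_skipped[OF w l] by (auto simp: C_def)
  have ex: "\<exists>T\<in>?I. T \<subseteq> S" if S: "S \<in> skipped_intervals (last C) w C" for S
  proof -
    obtain i j where ij: "S = open_interval C i j" "j < length C" "S \<noteq> {}"
      using S unfolding skipped_intervals_def by blast
    then obtain m where m: "i < m" "m < j" "C ! m \<in> S" by (auto simp: open_interval_def)
    then obtain k where "m = Suc k" by (cases m) auto
    then have "{C ! Suc k} \<in> ?I" "{C ! Suc k} \<subseteq> S" using m ij(2) by (auto simp: C_def)
    then show ?thesis by blast
  qed
  have ne: "S \<noteq> {}" if "S \<in> skipped_intervals (last C) w C" for S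
    using that by (auto simp: skipped_intervals_def)
  have M: "MSIs (last C) w C = ?I"
  proof
    show "MSIs (last C) w C \<subseteq> ?I"
    proof
      fix S assume S: "S \<in> MSIs (last C) w C"
      then have S': "S \<in> skipped_intervals (last C) w C"
        "\<And>K. K \<in> skipped_intervals (last C) w C \<Longrightarrow> \<not> K \<subset> S"
        unfolding MSIs_def by blast+
      obtain T where T: "T \<in> ?I" "T \<subseteq> S" using ex[OF S'(1)] by (rule bexE)
      have "\<not> T \<subset> S" using S'(2)[OF subsetD[OF sk T(1)]] .
      then have "T = S" using T(2) by (simp add: psubset_eq)
      then show "S \<in> ?I" using T(1) by simp
    qed
    show "?I \<subseteq> MSIs (last C) w C"
    proof
      fix S assume S: "S \<in> ?I"
      then obtain x where x: "S = {x}" by blast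
      have "\<not> K \<subset> S" if "K \<in> skipped_intervals (last C) w C" for K
        using ne[OF that] x by (metis psubset_eq subset_singletonD)
      moreover have "S \<in> skipped_intervals (last C) w C" using sk S by (rule subsetD)
      ultimately show "S \<in> MSIs (last C) w C" unfolding MSIs_def by simp
    qed
  qed
  have "finite ?I"
    by (rule finite_subset[of _ "(\<lambda>k. {C ! Suc k}) ` {..<length l}"]) auto
  then have "J_intervals (last C) w C = ?I"
    unfolding J_intervals_def M by (rule Union_J_rounds_singletons) auto
  moreover have "\<Union>?I = open_interval C 0 (length C - 1)"
  proof -
    have "length C - 1 = length l" by (simp add: C_def)
    then show ?thesis unfolding open_interval_def by (auto simp: gr0_conv_Suc)
  qed
  ultimately show ?thesis
    unfolding critical_chain_def using max_chains_iff[OF w] l(1) by (auto simp: C_def)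
qed

section \<open>Counting critical chains of strong descents\<close>

definition descending_list :: "nat set \<Rightarrow> nat list" where
  "descending_list S = rev (sorted_list_of_set S)"

lemma descending_list:
  assumes "finite S"
  shows "set (descending_list S) = S" "sorted_wrt (>) (descending_list S)"
    and "length (descending_list S) = card S" "distinct (descending_list S)"
  using assms strict_sorted_list_of_set[of S] by (auto simp: descending_list_def sorted_wrt_rev)

lemma descending_list_set: "sorted_wrt (>) l \<Longrightarrow> descending_list (set l) = l"
proof -
  assume "sorted_wrt (>) l"
  then have "sorted_wrt (<) (rev l)" by (simp add: sorted_wrt_rev)
  then have "sorted_list_of_set (set (rev l)) = rev l"
    by (simp only: sorted_list_of_set.idem_if_sorted_distinct strict_sorted_iff)
  then show ?thesis by (simp add: descending_list_def)
qed

lemma foldl_emb_reduce_lower: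
  assumes "distinct l" "set l \<inter> T = {}" "set l \<subseteq> {..<length w}"
  shows "foldl emb_reduce (lower w T) l = lower w (T \<union> set l)"
  using assms
proof (induction l arbitrary: T)
  case (Cons i l)
  then have "emb_reduce (lower w T) i = lower w (insert i T)"
    by (simp add: lower_insert emb_reduce_def)
  then show ?case using Cons.IH[of "insert i T"] Cons.prems by simp
qed simp

lemma red_pwords_iff: "w \<in> pwords \<Longrightarrow> red w i \<longleftrightarrow> word_reducible w i"
  using emb_reducible_pad[of w 0 0 i] by (simp add: strip_pwords)

lemma reducible_subset_id:
  assumes w: "w \<in> pwords" and S: "S \<subseteq> Collect (word_reducible w)"
  shows "valid_id w (descending_list S)" "strong_id w (descending_list S)"
    and "foldl emb_reduce w (descending_list S) = lower w S"
proof -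
  have fin: "finite S" using S finite_word_reducible finite_subset by blast
  note d = descending_list[OF fin]
  show "valid_id w (descending_list S)" "strong_id w (descending_list S)"
    using valid_strong_id_iff[OF contiguous_pwords[OF w], of "descending_list S"] d S red_pwords_iff[OF w]
    by auto
  have "S \<subseteq> {..<length w}" using S by (auto simp: word_reducible_def)
  then show "foldl emb_reduce w (descending_list S) = lower w S"
    using foldl_emb_reduce_lower[of "descending_list S" "{}" w] d by simp
qed

text \<open>\<open>lower w S\<close> is reached by reducing the positions of \<open>S\<close> from
  right to left; each step keeps the embedding contiguous and lowers the rank by one.\<close>

lemma contiguous_lower:
  assumes "w \<in> pwords" "S \<subseteq> Collect (word_reducible w)"
  shows "contiguous (lower w S)" "sum_list (lower w S) + card S = sum_list w"
proof -
  have "finite S" using assms(2) finite_word_reducible finite_subset by blast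
  then show "contiguous (lower w S)" "sum_list (lower w S) + card S = sum_list w"
    using reducible_subset_id[OF assms] valid_id_contiguous[OF contiguous_pwords[OF assms(1)]]
      valid_id_sum_list[of w "descending_list S"] descending_list(3) by metis+
qed

text \<open>A set \<open>S\<close> corresponds to the chain that lowers its positions in decreasing
  order; conversely a chain of strong descents is recovered from its set of labels. Criticality
  comes from \<open>critical_strong_chain\<close>.\<close>

lemma card_critical_strong_chains:
  assumes w: "w \<in> pwords"
  shows "card {C. critical_chain u w C \<and> (\<forall>i. 0 < i \<and> Suc i < length C \<longrightarrow> strong_descent C i)} =
    card {S \<in> Pow (Collect (word_reducible w)). strip (lower w S) = u}"
proof -
  let ?X = "{C. critical_chain u w C \<and> (\<forall>i. 0 < i \<and> Suc i < length C \<longrightarrow> strong_descent C i)}"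
  let ?Y = "{S \<in> Pow (Collect (word_reducible w)). strip (lower w S) = u}"
  let ?f = "\<lambda>S. chain_words w (descending_list S)"
  have strong: "(\<forall>i. 0 < i \<and> Suc i < length (chain_words w l) \<longrightarrow> strong_descent (chain_words w l) i) \<longleftrightarrow>
      strong_id w l" if "valid_id w l" for l
  proof -
    let ?C = "chain_words w l"
    have "(\<forall>i. 0 < i \<and> Suc i < length ?C \<longrightarrow> strong_descent ?C i) \<longleftrightarrow>
        (\<forall>k. Suc k < length l \<longrightarrow> strong_descent ?C (Suc k))"
      by (auto simp: gr0_conv_Suc)
    also have "\<dots> \<longleftrightarrow> strong_id w l"
      unfolding strong_id_iff_nth strong_descent_def descent_def chain_id_chain_words[OF w that] by auto
    finally show ?thesis .
  qed
  have "bij_betw ?f ?Y ?X"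
  proof (rule bij_betw_imageI)
    show "inj_on ?f ?Y"
    proof (rule inj_onI)
      fix S T assume S: "S \<in> ?Y" and T: "T \<in> ?Y" and eq: "?f S = ?f T"
      have fin: "finite S" "finite T"
        using S T finite_word_reducible finite_subset by blast+
      have "descending_list S = descending_list T"
        using S T reducible_subset_id(1)[OF w] chain_words_inj[OF contiguous_pwords[OF w] _ _ eq] by blast
      then show "S = T" using descending_list(1) fin by metis
    qed
    show "?f ` ?Y = ?X"
    proof
      show "?f ` ?Y \<subseteq> ?X"
      proof
        fix C assume "C \<in> ?f ` ?Y"
        then obtain S where S: "S \<subseteq> Collect (word_reducible w)" "strip (lower w S) = u" "C = ?f S" by blast
        note r = reducible_subset_id[OF w S(1)]
        have "last C = u" using S r(3) by (simp add: last_chain_words)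
        then show "C \<in> ?X" using critical_strong_chain[OF w r(1,2)] strong[OF r(1)] r(2) S(3) by auto
      qed
      show "?X \<subseteq> ?f ` ?Y"
      proof
        fix C assume C: "C \<in> ?X"
        then obtain l where l: "valid_id w l" "C = chain_words w l" "last C = u"
          using max_chains_iff[OF w] by (auto simp: critical_chain_def)
        have "strong_id w l" using C strong[OF l(1)] l(2) by auto
        then have s: "sorted_wrt (>) l" "set l \<subseteq> Collect (word_reducible w)"
          using valid_strong_id_iff[OF contiguous_pwords[OF w], of l] l(1) red_pwords_iff[OF w] by auto
        have "strip (lower w (set l)) = u"
          using reducible_subset_id(3)[OF w s(2)] descending_list_set[OF s(1)] l
          by (simp add: last_chain_words)
        then show "C \<in> ?f ` ?Y"
          using s l(2) descending_list_set[OF s(1)] by (intro image_eqI[of _ _ "set l"]) auto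
      qed
    qed
  qed
  then show ?thesis by (rule bij_betw_same_card[symmetric])
qed

text \<open>All contributing \<open>S\<close> have \<open>rank_diff u w\<close> elements, so the sum
  is a count times one sign. For rank difference at most 1, where \<open>gf_d\<close> is set by
  convention, exactly one \<open>S\<close> contributes: the empty set, or the one position whose
  reduction gives \<open>u\<close>.\<close>

lemma gf_d_eq_signed_sum:
  assumes u: "u \<in> pwords" and w: "w \<in> pwords" and uw: "u \<le>\<^sub>g\<^sub>f w"
  shows "gf_d u w = (\<Sum>S\<in>Pow (Collect (word_reducible w)). (-1) ^ card S * of_bool (strip (lower w S) = u))"
proof -
  let ?R = "Collect (word_reducible w)"
  let ?Y = "{S \<in> Pow ?R. strip (lower w S) = u}"
  have card: "card S = rank_diff u w" if "S \<in> ?Y" for S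
    using contiguous_lower(2)[OF w, of S] sum_list_strip[of "lower w S"] that
    by (auto simp: rank_diff_def word_rank_def)
  have fin: "finite ?R" by (rule finite_word_reducible)
  have "(\<Sum>S\<in>Pow ?R. (-1) ^ card S * of_bool (strip (lower w S) = u)) = (\<Sum>S\<in>?Y. (-1::int) ^ card S)"
    using fin by (simp add: sum.inter_filter of_bool_def del: Pow_iff) (intro sum.cong; simp)
  also have "\<dots> = int (card ?Y) * (-1) ^ rank_diff u w" using card by simp
  also have "\<dots> = gf_d u w"
  proof (cases "rank_diff u w > 1")
    case True
    then show ?thesis unfolding gf_d_def card_critical_strong_chains[OF w] by simp
  next
    case False
    have "\<exists>T. ?Y = {T}"
    proof (cases "u = w")
      case True
      have "?Y = {{}}"
      proof (intro equalityI subsetI)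
        fix S assume "S \<in> ?Y"
        moreover from this have "finite S" using fin finite_subset by blast
        ultimately show "S \<in> {{}}" using card[of S] True by (auto simp: rank_diff_def)
      qed (use True w in \<open>auto simp: strip_pwords\<close>)
      then show ?thesis by blast
    next
      case neq: False
      then have r1: "rank_diff u w = 1"
        using False gf_less_rank[OF uw _ w] by (simp add: rank_diff_def)
      obtain j where j: "word_reducible w j" "u \<le>\<^sub>g\<^sub>f word_reduce w j"
        using gf_less_word_reduce[OF w u uw neq] by blast
      have wj: "word_reduce w j \<in> pwords" using word_reduce_in_pwords w j by blast
      have uj: "u = word_reduce w j"
        using gf_less_rank[OF j(2) _ wj] sum_list_word_reduce[OF w j(1)] r1
        unfolding rank_diff_def word_rank_def by linarith
      have st: "strip (lower w {i}) = word_reduce w i" if i: "word_reducible w i" for i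
      proof -
        have il: "i < length w" using that by (simp add: word_reducible_def)
        have "lower w {i} = emb_reduce w i" using il lower_insert[of i "{}" w] by (simp add: emb_reduce_def)
        moreover obtain a b where
          "emb_reduce w i = replicate a 0 @ word_reduce w i @ replicate b 0"
          using emb_reduce_pad[OF w i, of 0 0] by auto
        ultimately show ?thesis using strip_pad[OF word_reduce_in_pwords[OF w that]] by simp
      qed
      have "?Y = {{j}}"
      proof (intro equalityI subsetI)
        fix S assume S: "S \<in> ?Y"
        then obtain i where i: "S = {i}" using card[OF S] r1 by (auto simp: card_1_singleton_iff)
        then have "word_reducible w i" "word_reduce w i = word_reduce w j" using S st uj by auto
        then show "S \<in> {{j}}" using i word_reduce_inj j(1) by blast
      qed (use j st uj in auto)
      then show ?thesis by blast
    qed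
    then have "card ?Y = 1" by (auto simp: card_1_singleton_iff)
    then show ?thesis using False by (simp add: gf_d_def)
  qed
  finally show ?thesis by simp
qed

subsection \<open>Moebius inversion\<close>

text \<open>A stripping is determined by its length, so summing over the number of removed ones is
  summing over a set of distinct words.\<close>

lemma gf_nu_eq_sum: "gf_nu u p = (\<Sum>x\<in>ones_stripped p. gf_mu u x)"
proof -
  let ?I = "{i \<in> {..length p}. \<exists>x. p = x @ replicate i 1}"
  have "gf_nu u p = (\<Sum>i\<le>length p. if \<exists>x. p = x @ replicate i 1 then gf_mu u (take (length p - i) p) else 0)"
    unfolding gf_nu_def remove_ones_def by (intro sum.cong) auto
  also have "\<dots> = (\<Sum>i\<in>?I. gf_mu u (take (length p - i) p))"
    by (rule sum.inter_filter[symmetric]) simp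
  also have "\<dots> = (\<Sum>x\<in>ones_stripped p. gf_mu u x)"
  proof (rule sum.reindex_bij_betw)
    show "bij_betw (\<lambda>i. take (length p - i) p) ?I (ones_stripped p)"
    proof (rule bij_betw_byWitness[where f' = "\<lambda>x. length p - length x"])
      show "(\<lambda>i. take (length p - i) p) ` ?I \<subseteq> ones_stripped p"
        by (force simp: ones_stripped_def)
      show "(\<lambda>x. length p - length x) ` ones_stripped p \<subseteq> ?I"
        by (force simp: ones_stripped_def)
    qed (auto simp: ones_stripped_def)
  qed
  finally show ?thesis .
qed

lemma finite_ones_stripped: "finite (ones_stripped p)"
proof (rule finite_subset)
  show "ones_stripped p \<subseteq> (\<lambda>i. take i p) ` {..length p}"
  proof
    fix x assume "x \<in> ones_stripped p"
    then have "x = take (length x) p" "length x \<le> length p" by (auto simp: ones_stripped_def)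
    then show "x \<in> (\<lambda>i. take i p) ` {..length p}" by blast
  qed
qed simp

lemma nu_diff_eq_sum_lost_factors:
  "gf_nu u p - (case primary_prefix v p of None \<Rightarrow> 0 | Some x \<Rightarrow> gf_nu u x) =
    (\<Sum>z\<in>lost_factors v p. gf_mu u z)"
proof (cases "primary_prefix v p")
  case None
  then show ?thesis by (simp add: lost_factors_def gf_nu_eq_sum)
next
  case (Some x)
  obtain m where "p = x @ replicate m 1"
    using primary_prefixD(2)[OF Some] by (auto simp: ones_stripped_def)
  then have "ones_stripped x \<subseteq> ones_stripped p"
    by (auto simp: ones_stripped_def simp flip: replicate_add)
  then show ?thesis
    using Some finite_ones_stripped by (simp add: lost_factors_def gf_nu_eq_sum sum_diff)
qed

lemma lost_factor_word:
  assumes "(v, p) \<in> principal_pairs w" "z \<in> lost_factors v p" "w \<in> pwords"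
  shows "z \<in> pwords" "\<not> flat z" "z \<le>\<^sub>g\<^sub>f w"
proof -
  have p: "principal_factor p v" "is_base v w" using assms(1) by (auto simp: principal_pairs_iff)
  have o: "outer_factor p v" "p \<in> pwords" "\<not> flat p"
    using p(1) by (auto simp: principal_factor_def maximal_outer_factor_def outer_factor_def)
  have z: "z \<in> ones_stripped p" using assms(2) by (simp add: lost_factors_def)
  show "z \<in> pwords" "\<not> flat z" using ones_strippedD[OF z o(2,3)] by blast+
  have "z \<le>\<^sub>g\<^sub>f v"
    using repeated_ones_stripped[OF o(1) z] by (auto simp: repeated_def gf_le_iff_occurs)
  then show "z \<le>\<^sub>g\<^sub>f w" using base_gf_le[OF p(2) assms(3)] gf_le_trans by blast
qed

text \<open>If \<open>z\<close> or \<open>w\<close> is flat the pairs contribute nothing, since lost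
  factors are nonflat words below \<open>w\<close>. Otherwise inclusion-exclusion on occurrences at
  position 0 and at positive positions leads to the three signed sums.\<close>

lemma signed_sum_gf_le:
  assumes z: "z \<in> pwords" and w: "w \<in> pwords"
  shows "(\<Sum>S\<in>Pow (Collect (word_reducible w)). (-1) ^ card S * of_bool (z \<le>\<^sub>g\<^sub>f strip (lower w S))) =
    of_bool (z = w) -
    (\<Sum>(v, p)\<in>principal_pairs w. (-1) ^ base_degree v w * (of_bool (z \<in> lost_factors v p) :: int))"
    (is "?L = _ - ?Q")
proof -
  let ?R = "Collect (word_reducible w)"
  let ?\<Sigma> = "\<lambda>P. \<Sum>S\<in>Pow ?R. (-1) ^ card S * (of_bool (P S) :: int)"
  have L: "?L = ?\<Sigma> (\<lambda>S. z \<le>\<^sub>g\<^sub>f lower w S)"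
    using gf_le_strip[OF contiguous_lower(1)[OF w] z] by (intro sum.cong) auto
  show ?thesis
  proof (cases "flat z \<or> flat w")
    case True
    then have "z \<notin> lost_factors v p" if "(v, p) \<in> principal_pairs w" for v p
      using lost_factor_word[OF that _ w] gf_le_flat[of w z] by blast
    then have "?Q = 0" by (intro sum.neutral) auto
    moreover have "?\<Sigma> (\<lambda>S. z \<le>\<^sub>g\<^sub>f lower w S) = of_bool (z = w)"
      using signed_sum_flat[OF w _ z] signed_sum_flat_factor[OF _ w] True by (cases "flat w") auto
    ultimately show ?thesis unfolding L by simp
  next
    case False
    then have "w \<noteq> []" by (auto simp: flat_def)
    have "?\<Sigma> (\<lambda>S. z \<le>\<^sub>g\<^sub>f lower w S) = ?\<Sigma> (\<lambda>S. occurs_at z (lower w S) 0) +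
        ?\<Sigma> (\<lambda>S. \<exists>k>0. occurs_at z (lower w S) k) - ?\<Sigma> (\<lambda>S. repeated z (lower w S))"
      unfolding sum.distrib[symmetric] sum_subtractf[symmetric]
    proof (intro sum.cong refl)
      fix S
      have "z \<le>\<^sub>g\<^sub>f lower w S \<longleftrightarrow> occurs_at z (lower w S) 0 \<or> (\<exists>k>0. occurs_at z (lower w S) k)"
        unfolding gf_le_iff_occurs by (metis gr0I)
      then show "(-1) ^ card S * (of_bool (z \<le>\<^sub>g\<^sub>f lower w S) :: int) =
        (-1) ^ card S * of_bool (occurs_at z (lower w S) 0) +
        (-1) ^ card S * of_bool (\<exists>k>0. occurs_at z (lower w S) k) -
        (-1) ^ card S * of_bool (repeated z (lower w S))"
        by (cases "occurs_at z (lower w S) 0"; cases "\<exists>k>0. occurs_at z (lower w S) k")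
          (simp_all only: repeated_def, simp_all)
    qed
    then show ?thesis
      unfolding L using False signed_sum_prefix[OF z w] signed_sum_nonprefix[OF w \<open>w \<noteq> []\<close>]
        signed_sum_repeated[OF w z] by simp
  qed
qed

text \<open>\<open>gf_mu u z\<close> vanishes unless \<open>u \<le>\<^sub>g\<^sub>f z\<close>, so
  the sum over the whole down-set equals the one over the interval.\<close>

lemma gf_mu_sum_below:
  assumes "u \<in> pwords" "y \<in> pwords"
  shows "(\<Sum>z\<in>{z \<in> pwords. z \<le>\<^sub>g\<^sub>f y}. gf_mu u z) = of_bool (u = y)"
proof -
  have fin: "finite {z \<in> pwords. z \<le>\<^sub>g\<^sub>f y}" using finite_gf_le by (rule rev_finite_subset) blast
  have "(\<Sum>z\<in>{z \<in> pwords. z \<le>\<^sub>g\<^sub>f y}. gf_mu u z) =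
      (\<Sum>z\<in>{z \<in> pwords. u \<le>\<^sub>g\<^sub>f z \<and> z \<le>\<^sub>g\<^sub>f y}. gf_mu u z)"
    using fin by (intro sum.mono_neutral_right) (auto simp: gf_mu.simps)
  also have "\<dots> = of_bool (u = y)"
  proof (cases "u = y")
    case True
    have "{z \<in> pwords. u \<le>\<^sub>g\<^sub>f z \<and> z \<le>\<^sub>g\<^sub>f y} = {y}"
      using gf_less_rank[of _ y] gf_less_rank[of y] gf_le_refl[of y] assms(2) True by fastforce
    then show ?thesis using True assms gf_mu_refl by simp
  next
    case False
    show ?thesis
    proof (cases "u \<le>\<^sub>g\<^sub>f y")
      case True
      then show ?thesis using gf_mu_sum[OF assms True False] False by simp
    next
      case n: False
      then have "{z \<in> pwords. u \<le>\<^sub>g\<^sub>f z \<and> z \<le>\<^sub>g\<^sub>f y} = {}" using gf_le_trans by blast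
      then show ?thesis using False by (simp only: sum.empty of_bool_eq)
    qed
  qed
  finally show ?thesis .
qed

theorem theorem3p17:
  fixes u w :: "nat list"
  assumes "u \<in> pwords" and "w \<in> pwords" and "u \<le>\<^sub>g\<^sub>f w"
  shows "gf_mu u w = gf_d u w +
    (\<Sum>(v, p) \<in> {(v, p). \<exists>i. principal_factor_deg p w i v}.
       (-1) ^ base_degree v w *
       (gf_nu u p - (case primary_prefix v p of None \<Rightarrow> 0 | Some x \<Rightarrow> gf_nu u x)))"
proof -
  let ?R = "Collect (word_reducible w)" and ?P = "principal_pairs w"
  let ?Z = "{z \<in> pwords. z \<le>\<^sub>g\<^sub>f w}"
  have fin: "finite ?Z" using finite_gf_le by (rule rev_finite_subset) blast
  \<comment> \<open>\<open>strip (lower w S)\<close> lies below \<open>w\<close>, so the part of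
    \<open>?Z\<close> below it is its full down-set and \<open>gf_mu_sum_below\<close>
    applies.\<close>
  have below: "(\<Sum>z\<in>?Z. gf_mu u z * of_bool (z \<le>\<^sub>g\<^sub>f strip (lower w S))) = of_bool (strip (lower w S) = u)"
    if "S \<in> Pow ?R" for S
  proof -
    let ?y = "strip (lower w S)"
    have "?y \<le>\<^sub>g\<^sub>f lower w S"
      using gf_le_strip[OF contiguous_lower(1)[OF assms(2)]] that gf_le_refl[of ?y] by auto
    moreover have "lower w S \<le>\<^sub>g\<^sub>f w" by (auto simp: gf_le_def intro!: exI[of _ 0])
    ultimately have "?y \<le>\<^sub>g\<^sub>f w" using gf_le_trans by blast
    then have Z: "{z \<in> ?Z. z \<le>\<^sub>g\<^sub>f ?y} = {z \<in> pwords. z \<le>\<^sub>g\<^sub>f ?y}" using gf_le_trans by blast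
    have "(\<Sum>z\<in>?Z. gf_mu u z * of_bool (z \<le>\<^sub>g\<^sub>f ?y)) = (\<Sum>z\<in>?Z. if z \<le>\<^sub>g\<^sub>f ?y then gf_mu u z else 0)"
      by (rule sum.cong) simp_all
    also have "\<dots> = (\<Sum>z\<in>{z \<in> ?Z. z \<le>\<^sub>g\<^sub>f ?y}. gf_mu u z)"
      by (rule sum.inter_filter[OF fin, symmetric])
    also have "\<dots> = of_bool (?y = u)" unfolding Z using gf_mu_sum_below[OF assms(1), of ?y] by auto
    finally show ?thesis .
  qed
  have lost: "(\<Sum>z\<in>?Z. gf_mu u z * of_bool (z \<in> lost_factors v p)) =
      gf_nu u p - (case primary_prefix v p of None \<Rightarrow> 0 | Some x \<Rightarrow> gf_nu u x)"
    if "(v, p) \<in> ?P" for v p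
  proof -
    have Z: "{z \<in> ?Z. z \<in> lost_factors v p} = lost_factors v p"
      using lost_factor_word[OF that _ assms(2)] by blast
    have "(\<Sum>z\<in>?Z. gf_mu u z * of_bool (z \<in> lost_factors v p)) =
        (\<Sum>z\<in>?Z. if z \<in> lost_factors v p then gf_mu u z else 0)"
      by (rule sum.cong) simp_all
    also have "\<dots> = (\<Sum>z\<in>{z \<in> ?Z. z \<in> lost_factors v p}. gf_mu u z)"
      by (rule sum.inter_filter[OF fin, symmetric])
    finally show ?thesis unfolding Z nu_diff_eq_sum_lost_factors .
  qed
  \<comment> \<open>The identity \<open>signed_sum_gf_le\<close> is multiplied by
    \<open>gf_mu u z\<close> and summed over all \<open>z\<close> below \<open>w\<close>; the
    indicator of \<open>z = w\<close> leaves \<open>gf_mu u w\<close>.\<close>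
  have "gf_mu u w = (\<Sum>z\<in>?Z. if z = w then gf_mu u z else 0)"
    using fin assms(2) gf_le_refl by (simp add: sum.delta)
  also have "\<dots> = (\<Sum>z\<in>?Z.
      (\<Sum>S\<in>Pow ?R. (-1) ^ card S * (gf_mu u z * of_bool (z \<le>\<^sub>g\<^sub>f strip (lower w S)))) +
      (\<Sum>(v, p)\<in>?P. (-1) ^ base_degree v w * (gf_mu u z * of_bool (z \<in> lost_factors v p))))"
  proof (rule sum.cong[OF refl])
    fix z assume "z \<in> ?Z"
    then have "of_bool (z = w) =
        (\<Sum>S\<in>Pow ?R. (-1) ^ card S * of_bool (z \<le>\<^sub>g\<^sub>f strip (lower w S))) +
        (\<Sum>(v, p)\<in>?P. (-1) ^ base_degree v w * (of_bool (z \<in> lost_factors v p) :: int))"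
      using signed_sum_gf_le[OF _ assms(2), of z] by simp
    then have "gf_mu u z * of_bool (z = w) =
        gf_mu u z * (\<Sum>S\<in>Pow ?R. (-1) ^ card S * of_bool (z \<le>\<^sub>g\<^sub>f strip (lower w S))) +
        gf_mu u z * (\<Sum>(v, p)\<in>?P. (-1) ^ base_degree v w * of_bool (z \<in> lost_factors v p))"
      by (simp only: distrib_left)
    moreover have "(if z = w then gf_mu u z else 0) = gf_mu u z * of_bool (z = w)" by simp
    ultimately show "(if z = w then gf_mu u z else 0) =
      (\<Sum>S\<in>Pow ?R. (-1) ^ card S * (gf_mu u z * of_bool (z \<le>\<^sub>g\<^sub>f strip (lower w S)))) +
      (\<Sum>(v, p)\<in>?P. (-1) ^ base_degree v w * (gf_mu u z * of_bool (z \<in> lost_factors v p)))"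
      unfolding sum_distrib_left case_prod_unfold by (simp only: ac_simps)
  qed
  also have "\<dots> = (\<Sum>S\<in>Pow ?R. (-1) ^ card S *
        (\<Sum>z\<in>?Z. gf_mu u z * of_bool (z \<le>\<^sub>g\<^sub>f strip (lower w S)))) +
      (\<Sum>(v, p)\<in>?P. (-1) ^ base_degree v w *
        (\<Sum>z\<in>?Z. gf_mu u z * of_bool (z \<in> lost_factors v p)))"
    unfolding sum.distrib sum_distrib_left case_prod_unfold
    by (intro arg_cong2[where f = "(+)"] sum.swap)
  also have "(\<Sum>S\<in>Pow ?R. (-1) ^ card S *
      (\<Sum>z\<in>?Z. gf_mu u z * of_bool (z \<le>\<^sub>g\<^sub>f strip (lower w S)))) = gf_d u w"
    unfolding gf_d_eq_signed_sum[OF assms] using below by (intro sum.cong) simp_all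
  also have "(\<Sum>(v, p)\<in>?P. (-1) ^ base_degree v w *
        (\<Sum>z\<in>?Z. gf_mu u z * of_bool (z \<in> lost_factors v p))) =
      (\<Sum>(v, p)\<in>?P. (-1) ^ base_degree v w *
        (gf_nu u p - (case primary_prefix v p of None \<Rightarrow> 0 | Some x \<Rightarrow> gf_nu u x)))"
    using lost by (intro sum.cong) auto
  finally show ?thesis unfolding principal_pairs_def .
qed

end
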